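(* Let the family of meshes $\{\mathcal T_h\}_{h>0}$ be weakly acute. Then for every $h>0$ and $\varepsilon>0$ there exists a unique $u_h^\varepsilon\in\mathbb V_h^0$ such that \[ \frac\lambda2\Delta_hu_h^\varepsilon(z)+\inf_{\alpha\in\mathcal A}\sup_{\beta\in\mathcal B}I_\varepsilon^{\alpha,\beta}[u_h^\varepsilon](z)=f_z\qquad\forall z\in\mathcal N_h. \]
   Context: Setting: $\Omega\subset\mathbb{R}^d$ ($d\ge2$) open, bounded, convex; $f\in C^{0,1}(\bar\Omega)$; $\mathcal A,\mathcal B$ finite nonempty sets; $A^{\alpha,\beta}\in C^{0,1}(\bar\Omega)$ symmetric-matrix-valued with $\lambda I\le A^{\alpha,\beta}\le\Lambda I$, $0<\lambda\le\Lambda$; $M^{\alpha,\beta}(x)=(A^{\alpha,\beta}(x)-\frac\lambda2 I)^{1/2}$. $\varphi$ is a fixed radially symmetric smooth function supported in the unit ball with $\int|y|^2\varphi(y)dy=d$. $Q=\sqrt{2/\lambda}$, $\Omega_\varepsilon=\Omega\cup\{x:\operatorname{dist}(x,\partial\Omega)\le Q\varepsilon\}$. For $w\in C(\bar\Omega_\varepsilon)$, $\delta w(x,y)=w(x+y)-2w(x)+w(x-y)$ and $I_\varepsilon^{\alpha,\beta}[w](x)=\frac{1}{\varepsilon^{d+2}\det M^{\alpha,\beta}(x)}\int_{\mathbb{R}^d}\delta w(x,y)\varphi(\varepsilon^{-1}M^{\alpha,\beta}(x)^{-1}y)\,dy$. $\mathcal T_h$ is a quasi-uniform simplicial mesh of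 $\Omega$ of size $h$ with interior nodes $\mathcal N_h$; $\mathbb V_h^0$ = continuous piecewise-linear functions on $\mathcal T_h$ vanishing on $\partial\Omega$, extended by zero to $\Omega_\varepsilon$; $\{\phi_z\}_{z\in\mathcal N_h}$ its nodal basis. Weakly acute: all dihedral angles of the simplices are at most $\pi/2$. $\Delta_hw_h(z)=-\left(\int_\Omega\phi_z\right)^{-1}\int_\Omega\nabla w_h\cdot\nabla\phi_z$ and $f_z=\left(\int_\Omega\phi_z\right)^{-1}\int_\Omega f\phi_z$.
   Formalization: The kernel φ is additionally assumed nonnegative; for sign-changing φ with the stated normalization the claim can fail (e.g. one interior node, where the nonlocal term can cancel the discrete Laplacian). *)

theory Defs
  imports "HOL-Analysis.Analysis"
begin

definition partial_deriv :: "'d::finite \<Rightarrow> (real^'d \<Rightarrow> real) \<Rightarrow> real^'d \<Rightarrow> real" where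
  "partial_deriv i f x = frechet_derivative f (at x) (axis i 1)"

fun iter_partial :: "'d::finite list \<Rightarrow> (real^'d \<Rightarrow> real) \<Rightarrow> real^'d \<Rightarrow> real" where
  "iter_partial [] f = f"
| "iter_partial (i # is) f = partial_deriv i (iter_partial is f)"

definition smooth_fun :: "(real^'d::finite \<Rightarrow> real) \<Rightarrow> bool" where
  "smooth_fun f \<longleftrightarrow> (\<forall>is x. iter_partial is f differentiable (at x))"

definition radially_symmetric :: "(real^'d::finite \<Rightarrow> real) \<Rightarrow> bool" where
  "radially_symmetric f \<longleftrightarrow> (\<forall>x y. norm x = norm y \<longrightarrow> f x = f y)"

definition sym_matrix :: "real^'n^'n \<Rightarrow> bool" where
  "sym_matrix S \<longleftrightarrow> transpose S = S"

definition psd_matrix :: "real^'n^'n \<Rightarrow> bool" where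
  "psd_matrix S \<longleftrightarrow> sym_matrix S \<and> (\<forall>v. 0 \<le> v \<bullet> (S *v v))"

definition matrix_sqrt :: "real^'n^'n \<Rightarrow> real^'n^'n" where
  "matrix_sqrt B = (THE S. psd_matrix S \<and> S ** S = B)"

text \<open>A simplex is represented by its (finite) vertex set; the geometric simplex is its
  convex hull.  A (conforming) simplicial mesh of \<open>\<Omega>\<close>: finitely many non-degenerate
  d-simplices covering the closure of \<open>\<Omega>\<close>, any two meeting in a common (possibly empty) face.\<close>
definition simplicial_mesh :: "(real^'d::finite) set set \<Rightarrow> (real^'d) set \<Rightarrow> bool" where
  "simplicial_mesh T \<Omega> \<longleftrightarrow>
     finite T \<and> T \<noteq> {} \<and>
     (\<forall>K\<in>T. finite K \<and> card K = CARD('d) + 1 \<and> \<not> affine_dependent K) \<and>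
     \<Union> ((\<lambda>K. convex hull K) ` T) = closure \<Omega> \<and>
     (\<forall>K\<in>T. \<forall>K'\<in>T. convex hull K \<inter> convex hull K' = convex hull (K \<inter> K'))"

text \<open>Inward normal of the facet of simplex \<open>K\<close> opposite to vertex \<open>v\<close>.\<close>
definition facet_normal :: "(real^'d::finite) set \<Rightarrow> real^'d \<Rightarrow> real^'d" where
  "facet_normal K v = v - closest_point (affine hull (K - {v})) v"

definition dihedral_angle :: "(real^'d::finite) set \<Rightarrow> real^'d \<Rightarrow> real^'d \<Rightarrow> real" where
  "dihedral_angle K v w =
     pi - arccos ((facet_normal K v \<bullet> facet_normal K w) /
                  (norm (facet_normal K v) * norm (facet_normal K w)))"

definition weakly_acute :: "(real^'d::finite) set set \<Rightarrow> bool" where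
  "weakly_acute T \<longleftrightarrow>
     (\<forall>K\<in>T. \<forall>v\<in>K. \<forall>w\<in>K. v \<noteq> w \<longrightarrow> dihedral_angle K v w \<le> pi / 2)"

definition quasi_uniform_family :: "real set \<Rightarrow> (real \<Rightarrow> (real^'d::finite) set set) \<Rightarrow> bool" where
  "quasi_uniform_family H T \<longleftrightarrow>
     (\<exists>\<sigma>>0. \<forall>h\<in>H. \<forall>K\<in>T h.
        diameter (convex hull K) \<le> h \<and> (\<exists>c. ball c (\<sigma> * h) \<subseteq> convex hull K))"

definition mesh_nodes :: "(real^'d::finite) set set \<Rightarrow> (real^'d) set \<Rightarrow> (real^'d) set" where
  "mesh_nodes T \<Omega> = (\<Union>T) \<inter> \<Omega>"

text \<open>Continuous piecewise linear functions vanishing on the boundary, extended by zero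
  outside \<open>\<Omega>\<close> (to all of \<open>\<real>^d\<close>, which contains \<open>\<Omega>_\<epsilon>\<close>).\<close>
definition V0 :: "(real^'d::finite) set set \<Rightarrow> (real^'d) set \<Rightarrow> (real^'d \<Rightarrow> real) set" where
  "V0 T \<Omega> = {w. continuous_on UNIV w \<and> (\<forall>x. x \<notin> \<Omega> \<longrightarrow> w x = 0) \<and>
                 (\<forall>K\<in>T. \<exists>a b. \<forall>x\<in>convex hull K. w x = a \<bullet> x + b)}"

definition nodal_basis :: "(real^'d::finite) set set \<Rightarrow> (real^'d) set \<Rightarrow> real^'d \<Rightarrow> real^'d \<Rightarrow> real" where
  "nodal_basis T \<Omega> z = (THE \<phi>. \<phi> \<in> V0 T \<Omega> \<and> \<phi> z = 1 \<and>
                              (\<forall>z'\<in>mesh_nodes T \<Omega>. z' \<noteq> z \<longrightarrow> \<phi> z' = 0))"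

definition grad :: "(real^'d::finite \<Rightarrow> real) \<Rightarrow> real^'d \<Rightarrow> real^'d" where
  "grad w x = (\<chi> i. frechet_derivative w (at x) (axis i 1))"

definition discrete_laplacian ::
  "(real^'d::finite) set set \<Rightarrow> (real^'d) set \<Rightarrow> (real^'d \<Rightarrow> real) \<Rightarrow> real^'d \<Rightarrow> real" where
  "discrete_laplacian T \<Omega> w z =
     - (integral \<Omega> (\<lambda>x. grad w x \<bullet> grad (nodal_basis T \<Omega> z) x)) / integral \<Omega> (nodal_basis T \<Omega> z)"

definition nodal_average ::
  "(real^'d::finite) set set \<Rightarrow> (real^'d) set \<Rightarrow> (real^'d \<Rightarrow> real) \<Rightarrow> real^'d \<Rightarrow> real" where
  "nodal_average T \<Omega> f z =
     integral \<Omega> (\<lambda>x. f x * nodal_basis T \<Omega> z x) / integral \<Omega> (nodal_basis T \<Omega> z)"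

definition second_diff :: "(real^'d::finite \<Rightarrow> real) \<Rightarrow> real^'d \<Rightarrow> real^'d \<Rightarrow> real" where
  "second_diff w x y = w (x + y) - 2 * w x + w (x - y)"

definition Mmat :: "real \<Rightarrow> (real^'d::finite \<Rightarrow> real^'d^'d) \<Rightarrow> real^'d \<Rightarrow> real^'d^'d" where
  "Mmat lam A x = matrix_sqrt (A x - (lam / 2) *\<^sub>R mat 1)"

definition nonlocal_op ::
  "(real^'d::finite \<Rightarrow> real) \<Rightarrow> real \<Rightarrow> real \<Rightarrow> (real^'d \<Rightarrow> real^'d^'d) \<Rightarrow> (real^'d \<Rightarrow> real) \<Rightarrow> real^'d \<Rightarrow> real" where
  "nonlocal_op \<phi> \<epsilon> lam A w x =
     (1 / (\<epsilon> ^ (CARD('d) + 2) * det (Mmat lam A x))) *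
     integral UNIV (\<lambda>y. second_diff w x y * \<phi> ((1 / \<epsilon>) *\<^sub>R (matrix_inv (Mmat lam A x) *v y)))"

end

theory Submission
  imports Defs
begin

text \<open>The discrete operator is Lipschitz, positively homogeneous of degree one and satisfies a
  comparison principle on nodal values. Comparison for the nonlocal part holds because its kernel
  is nonnegative. Comparison for the Laplacian holds because in a weakly acute mesh the gradients of
  two barycentric coordinates of a simplex have a nonpositive inner product; a strong maximum
  principle makes it strict. Comparison yields uniqueness. For existence, a relaxation step is
  nonexpansive in the maximum norm, so its contractive perturbations have fixed points; by
  homogeneity and uniqueness for the zero right-hand side, rescaled fixed points converge to a
  multiple of a solution.\<close>

subsection \<open>Square roots of positive semidefinite matrices\<close>

text \<open>In general the inf-sup makes the scheme neither convex nor concave, so existence is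
  sought from comparison, homogeneity and a Lipschitz bound alone, all of which pass through an
  inf-sup over finite sets. Two obstacles shape the proof. Comparison is not strict node by node: on
  a plateau of maxima the Laplacian may vanish, so strictness is claimed at some maximum node only,
  and finding it uses the connectedness of the closure of \<Omega>. Moreover no quantitative
  stability bound is derived, so the fixed points of the perturbed steps might blow up; hence the
  rescaling. Square roots come first because \<open>matrix_sqrt\<close> is a definite description:
  existence and uniqueness of the root must be known before the determinant that normalizes the
  nonlocal operator can be shown positive.\<close>

lemma nonneg_quadratic_imp_linear_coeff_zero:
  fixes B C :: real
  assumes "\<And>t. 0 \<le> t * B + t\<^sup>2 * C"
  shows "B = 0"
proof -
  have C: "0 \<le> C" using assms[of 1] assms[of "-1"] by simp
  \<comment> \<open>Unlike the minimizer -B / (2C), this point makes sense for C = 0 too; the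
    quadratic takes the value \<open>- (t\<^sup>2)\<close> there.\<close>
  define t where "t = - B / (C + 1)"
  have t: "t * (C + 1) = - B" using C by (simp add: t_def)
  have "0 \<le> t * B + t\<^sup>2 * C" by (rule assms)
  also have "t * B + t\<^sup>2 * C = - (t\<^sup>2)" 
  proof -
    have "t * B + t\<^sup>2 * C = t * (B + t * C)" by (simp add: power2_eq_square algebra_simps)
    also have "B + t * C = - t" using t by (simp add: algebra_simps)
    finally show ?thesis by (simp add: power2_eq_square)
  qed
  finally have "t = 0" by simp
  then show ?thesis using t by simp
qed

text \<open>A maximizer of the Rayleigh quotient on the unit sphere of S works: the first variation
  makes the residual \<open>f v - \<mu> *\<^sub>R v\<close> orthogonal to S, and invariance puts the
  residual itself into S.\<close>

lemma selfadjoint_eigenvector: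
  fixes f :: "'a::euclidean_space \<Rightarrow> 'a"
  assumes lin: "linear f" and sa: "\<And>x y. x \<bullet> f y = f x \<bullet> y"
    and S: "subspace S" "f ` S \<subseteq> S" "S \<noteq> {0}"
  obtains v \<mu> where "v \<in> S" "norm v = 1" "f v = \<mu> *\<^sub>R v"
proof -
  obtain s where s: "s \<in> S" "s \<noteq> 0"
    using S(1,3) subspace_0 by fastforce
  let ?C = "sphere 0 1 \<inter> S"
  have "compact ?C" by (intro compact_Int_closed compact_sphere closed_subspace S)
  moreover have "s /\<^sub>R norm s \<in> ?C"
    using s S(1) by (auto simp: subspace_scale)
  then have "?C \<noteq> {}" by blast
  moreover have "continuous_on ?C (\<lambda>x. x \<bullet> f x)"
    by (intro continuous_intros linear_continuous_on_compose[OF _ lin])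
  ultimately obtain v where v: "v \<in> ?C" and max: "\<And>x. x \<in> ?C \<Longrightarrow> x \<bullet> f x \<le> v \<bullet> f v"
    by (meson continuous_attains_sup)
  have vS: "v \<in> S" and nv: "norm v = 1" using v by auto
  define \<mu> where "\<mu> = v \<bullet> f v"
  have q: "x \<bullet> f x \<le> \<mu> * (x \<bullet> x)" if "x \<in> S" for x
  proof (cases "x = 0")
    case False
    have "x /\<^sub>R norm x \<in> ?C" using that S(1) False by (auto simp: subspace_scale)
    from max[OF this] have "(x \<bullet> f x) / (norm x)\<^sup>2 \<le> \<mu>"
      by (simp add: linear_cmul[OF lin] \<mu>_def power2_eq_square divide_inverse mult_ac)
    then show ?thesis using False by (simp add: field_simps power2_norm_eq_inner)
  qed (simp add: linear_0[OF lin])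
  have orth: "w \<bullet> (f v - \<mu> *\<^sub>R v) = 0" if w: "w \<in> S" for w
  proof -
    have "2 * (\<mu> * (v \<bullet> w) - w \<bullet> f v) = 0"
    proof (rule nonneg_quadratic_imp_linear_coeff_zero)
      fix t
      have "v + t *\<^sub>R w \<in> S" using vS w S(1) by (simp add: subspace_add subspace_scale)
      from q[OF this]
      have "v \<bullet> f v + t * (v \<bullet> f w + w \<bullet> f v) + t\<^sup>2 * (w \<bullet> f w)
          \<le> \<mu> * (v \<bullet> v + 2 * t * (v \<bullet> w) + t\<^sup>2 * (w \<bullet> w))"
        by (simp add: linear_add[OF lin] linear_cmul[OF lin] algebra_simps inner_commute[of w v] power2_eq_square)
      moreover have "v \<bullet> f w = w \<bullet> f v" using sa[of v w] by (simp add: inner_commute)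
      moreover have "v \<bullet> v = 1" using nv by (simp add: norm_eq_1)
      ultimately show "0 \<le> t * (2 * (\<mu> * (v \<bullet> w) - w \<bullet> f v)) + t\<^sup>2 * (\<mu> * (w \<bullet> w) - w \<bullet> f w)"
        by (simp add: \<mu>_def algebra_simps)
    qed
    then show ?thesis by (simp add: inner_diff_right inner_commute)
  qed
  have "f v - \<mu> *\<^sub>R v \<in> S"
    using S vS by (auto intro!: subspace_diff subspace_scale)
  from orth[OF this] have "f v = \<mu> *\<^sub>R v" by simp
  with vS nv that show thesis by blast
qed

text \<open>The spectral theorem on an invariant subspace, because the induction passes to the
  orthogonal complement of an eigenvector within S, which f leaves invariant by
  self-adjointness.\<close>

lemma selfadjoint_eigenbasis:
  fixes f :: "'a::euclidean_space \<Rightarrow> 'a"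
  assumes lin: "linear f" and sa: "\<And>x y. x \<bullet> f y = f x \<bullet> y"
    and S: "subspace S" "f ` S \<subseteq> S"
  shows "\<exists>B. finite B \<and> B \<subseteq> S \<and> pairwise orthogonal B \<and> span B = S \<and>
            (\<forall>b\<in>B. norm b = 1 \<and> (\<exists>\<mu>. f b = \<mu> *\<^sub>R b))"
  using S
proof (induction "dim S" arbitrary: S rule: less_induct)
  case less
  show ?case
  proof (cases "S = {0}")
    case True
    then show ?thesis by (intro exI[of _ "{}"]) auto
  next
    case False
    obtain v \<mu> where v: "v \<in> S" "norm v = 1" "f v = \<mu> *\<^sub>R v"
      using selfadjoint_eigenvector[OF lin sa less.prems False] by blast
    define S' where "S' = S \<inter> {x. v \<bullet> x = 0}"
    have sub: "subspace S'"
      unfolding S'_def using less.prems(1) by (intro subspace_inter subspace_hyperplane)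
    have inv: "f ` S' \<subseteq> S'"
      using less.prems(2) by (auto simp: S'_def sa v(3))
    have "v \<notin> S'" using v by (auto simp: S'_def)
    moreover have "S' \<subseteq> S" by (simp add: S'_def)
    ultimately have "S' \<subset> S" using v(1) by blast
    then have "dim S' < dim S"
      using sub less.prems(1) by (metis dim_psubset span_eq_iff)
    from less.hyps[OF this sub inv] obtain B where B: "finite B" "B \<subseteq> S'" "pairwise orthogonal B"
        "span B = S'" "\<And>b. b \<in> B \<Longrightarrow> norm b = 1 \<and> (\<exists>\<mu>. f b = \<mu> *\<^sub>R b)"
      by blast
    have "S \<subseteq> span (insert v B)"
    proof
      fix x assume x: "x \<in> S"
      have "x - (v \<bullet> x) *\<^sub>R v \<in> S'"
        using x v less.prems(1)
        by (auto simp: S'_def inner_diff_right subspace_diff subspace_scale norm_eq_1)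
      then have "x - (v \<bullet> x) *\<^sub>R v \<in> span (insert v B)"
        using B(4) span_mono[of B "insert v B"] by blast
      then have "(x - (v \<bullet> x) *\<^sub>R v) + (v \<bullet> x) *\<^sub>R v \<in> span (insert v B)"
        by (rule span_add) (simp add: span_scale span_base)
      then show "x \<in> span (insert v B)" by simp
    qed
    moreover have "span (insert v B) \<subseteq> S"
      using v(1) B(2) less.prems(1) by (intro span_minimal) (auto simp: S'_def)
    moreover have "pairwise orthogonal (insert v B)"
      using B(2,3) by (auto simp: pairwise_insert orthogonal_def S'_def inner_commute)
    ultimately show ?thesis
      using B v by (intro exI[of _ "insert v B"]) (auto simp: S'_def)
  qed
qed

lemma sym_matrix_selfadjoint: "sym_matrix S \<Longrightarrow> x \<bullet> (S *v y) = (S *v x) \<bullet> y"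
  unfolding sym_matrix_def by (metis dot_lmul_matrix vector_transpose_matrix)

text \<open>The root g multiplies each eigenvector by the square root of its eigenvalue. Its
  spectral expansion makes symmetry and positivity visible in \<open>g_inner\<close>, while g o g =
  B needs checking on the eigenbasis only.\<close>

lemma psd_matrix_sqrt_exists:
  fixes B :: "real^'n^'n"
  assumes "psd_matrix B"
  shows "\<exists>S. psd_matrix S \<and> S ** S = B"
proof -
  have sym: "sym_matrix B" and pos: "\<And>v. 0 \<le> v \<bullet> (B *v v)"
    using assms by (auto simp: psd_matrix_def)
  obtain E where E: "finite E" "pairwise orthogonal E" "span E = (UNIV::(real^'n) set)"
      "\<And>b. b \<in> E \<Longrightarrow> norm b = 1 \<and> (\<exists>\<mu>. B *v b = \<mu> *\<^sub>R b)"
    using selfadjoint_eigenbasis[of "\<lambda>x. B *v x" UNIV] sym_matrix_selfadjoint[OF sym] by auto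
  then obtain \<mu> where \<mu>: "\<And>b. b \<in> E \<Longrightarrow> B *v b = \<mu> b *\<^sub>R b" by metis
  have n1: "b \<bullet> b = 1" if "b \<in> E" for b using E(4)[OF that] by (simp add: norm_eq_1)
  have \<mu>pos: "0 \<le> \<mu> b" if "b \<in> E" for b
    using pos[of b] \<mu>[OF that] n1[OF that] by simp
  have expand: "(\<Sum>b\<in>E. (b \<bullet> x) *\<^sub>R b) = x" for x
    using orthonormal_basis_expand[OF E(2) _ _ E(1), of x] E(3,4) by (simp add: inner_commute)
  define g where "g x = (\<Sum>b\<in>E. (sqrt (\<mu> b) * (b \<bullet> x)) *\<^sub>R b)" for x
  have lin: "linear g"
    unfolding g_def
    by (intro linearI) (simp_all add: inner_add_right algebra_simps sum.distrib scaleR_sum_right)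
  have gb: "g b = sqrt (\<mu> b) *\<^sub>R b" if b: "b \<in> E" for b
  proof -
    have "g b = (\<Sum>c\<in>E. if c = b then sqrt (\<mu> b) *\<^sub>R b else 0)"
      unfolding g_def
      by (rule sum.cong) (use E(2) b n1 in \<open>auto simp: pairwise_def orthogonal_def\<close>)
    then show ?thesis using b E(1) by simp
  qed
  have ggb: "g (g b) = B *v b" if "b \<in> E" for b
    using gb[OF that] \<mu>[OF that] \<mu>pos[OF that] by (simp add: linear_cmul[OF lin])
  have gg: "g (g x) = B *v x" for x
    by (rule linear_eq_on[of "\<lambda>x. g (g x)" "\<lambda>x. B *v x" x E])
      (use ggb E(3) in \<open>auto intro: linear_compose[OF lin lin, unfolded o_def]\<close>)
  have gx: "matrix g *v x = g x" for x using lin by (simp add: matrix_works)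
  have g_inner: "y \<bullet> g x = (\<Sum>b\<in>E. sqrt (\<mu> b) * (b \<bullet> x) * (b \<bullet> y))" for x y
    by (simp add: g_def inner_sum_right inner_commute)
  have gsym: "y \<bullet> g x = g y \<bullet> x" for x y
    using g_inner[of y x] g_inner[of x y] by (simp add: inner_commute[of "g y"] mult_ac)
  have "transpose (matrix g) = matrix g"
    by (metis adjoint_unique gsym inner_commute lin matrix_adjoint)
  moreover have "0 \<le> v \<bullet> (matrix g *v v)" for v
    unfolding gx g_inner using \<mu>pos by (intro sum_nonneg) (simp add: mult.assoc)
  moreover have "matrix g ** matrix g = B"
    by (simp add: matrix_eq matrix_vector_mul_assoc[symmetric] gx gg)
  ultimately show ?thesis by (auto simp: psd_matrix_def sym_matrix_def)
qed

text \<open>For an eigenvector \<open>v\<close> of \<open>D = S - R\<close> with eigenvalue \<open>\<mu>\<close>, the identity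
  \<open>S D + D R = S\<^sup>2 - R\<^sup>2 = 0\<close> gives \<open>\<mu> (v \<bullet> S v + v \<bullet> R v) = 0\<close>, hence \<open>\<mu> = 0\<close>.\<close>

lemma psd_matrix_sqrt_unique:
  fixes S R :: "real^'n^'n"
  assumes S: "psd_matrix S" and R: "psd_matrix R" and eq: "S ** S = R ** R"
  shows "S = R"
proof -
  let ?D = "\<lambda>x. S *v x - R *v x"
  have symS: "x \<bullet> (S *v y) = (S *v x) \<bullet> y" and symR: "x \<bullet> (R *v y) = (R *v x) \<bullet> y" for x y
    using S R sym_matrix_selfadjoint by (auto simp: psd_matrix_def)
  have lin: "linear ?D"
    by (intro linear_compose_sub) auto
  obtain E where E: "span E = (UNIV::(real^'n) set)"
      "\<And>b. b \<in> E \<Longrightarrow> norm b = 1 \<and> (\<exists>\<mu>. ?D b = \<mu> *\<^sub>R b)"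
    using selfadjoint_eigenbasis[OF lin, of UNIV]
    by (auto simp: inner_diff_left inner_diff_right symS symR)
  have "?D b = 0" if b: "b \<in> E" for b
  proof -
    obtain \<mu> where \<mu>: "?D b = \<mu> *\<^sub>R b" and nb: "b \<bullet> b = 1"
      using E(2)[OF b] by (auto simp: norm_eq_1)
    have "S *v (S *v b) = R *v (R *v b)"
      using eq by (simp add: matrix_vector_mul_assoc)
    then have "(S *v b) \<bullet> (S *v b) = (R *v b) \<bullet> (R *v b)"
      by (metis symS symR)
    then have "?D b \<bullet> (S *v b) + ?D b \<bullet> (R *v b) = 0"
      by (simp add: inner_diff_left inner_commute[of "R *v b" "S *v b"])
    then have *: "\<mu> * (b \<bullet> (S *v b) + b \<bullet> (R *v b)) = 0"
      by (simp add: \<mu> algebra_simps)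
    have "\<mu> = b \<bullet> ?D b" using \<mu> nb by simp
    then have **: "\<mu> = b \<bullet> (S *v b) - b \<bullet> (R *v b)" by (simp add: inner_diff_right)
    have "0 \<le> b \<bullet> (S *v b)" "0 \<le> b \<bullet> (R *v b)"
      using S R by (auto simp: psd_matrix_def)
    with * ** have "\<mu> = 0" by auto
    then show ?thesis using \<mu> by simp
  qed
  then have "?D x = 0" for x
    using linear_eq_on[OF lin linear_zero, of x E] E(1) by auto
  then show ?thesis by (simp add: matrix_eq)
qed

lemma matrix_sqrt_works:
  assumes "psd_matrix B"
  shows "psd_matrix (matrix_sqrt B)" "matrix_sqrt B ** matrix_sqrt B = B"
proof -
  have "\<exists>!S. psd_matrix S \<and> S ** S = B"
    using psd_matrix_sqrt_exists[OF assms] psd_matrix_sqrt_unique by blast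
  from theI'[OF this] show "psd_matrix (matrix_sqrt B)" "matrix_sqrt B ** matrix_sqrt B = B"
    by (simp_all add: matrix_sqrt_def)
qed

text \<open>The determinant is the square of that of the root.\<close>

lemma psd_matrix_det_nonneg:
  assumes "psd_matrix B"
  shows "0 \<le> det B"
  by (metis assms det_mul matrix_sqrt_works(2) zero_le_square)

text \<open>Subtracting lam / 2 from a matrix bounded below by lam leaves the lower bound lam / 2,
  hence injectivity. So the square of \<open>det (Mmat lam A x)\<close> is nonzero; the sign follows
  by taking a root of \<open>Mmat lam A x\<close> in turn.\<close>

lemma Mmat_det_pos:
  fixes A :: "real^'d::finite \<Rightarrow> real^'d^'d"
  assumes "0 < lam" "sym_matrix (A x)" "\<And>v. lam * (v \<bullet> v) \<le> v \<bullet> (A x *v v)"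
  shows "0 < det (Mmat lam A x)"
proof -
  let ?B = "A x - (lam / 2) *\<^sub>R mat 1"
  have Bv: "?B *v v = A x *v v - (lam / 2) *\<^sub>R v" for v
    by (simp add: matrix_vector_mult_diff_rdistrib scaleR_matrix_vector_assoc[symmetric])
  have pos: "(lam / 2) * (v \<bullet> v) \<le> v \<bullet> (?B *v v)" for v
    using assms(3)[of v] unfolding Bv by (simp add: inner_diff_right)
  have "transpose ?B = ?B"
    using assms(2) by (auto simp: sym_matrix_def transpose_def vec_eq_iff mat_def)
  moreover have "0 \<le> v \<bullet> (?B *v v)" for v
    using pos[of v] assms(1) by (smt (verit) inner_ge_zero mult_nonneg_nonneg half_gt_zero)
  ultimately have psd: "psd_matrix ?B" by (simp add: psd_matrix_def sym_matrix_def)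
  have "v = 0" if "?B *v v = 0" for v
  proof -
    have "v \<bullet> v \<le> 0" using pos[of v] that assms(1) by (simp add: mult_le_0_iff)
    then show ?thesis using inner_ge_zero[of v] by (metis antisym inner_eq_zero_iff)
  qed
  then have "inj ((*v) ?B)"
    by (simp add: linear_injective_0)
  then have "det ?B \<noteq> 0"
    using det_nz_iff_inj[of "(*v) ?B"] by (simp add: matrix_of_matrix_vector_mul)
  then have "det (Mmat lam A x) \<noteq> 0"
    using matrix_sqrt_works(2)[OF psd] unfolding Mmat_def by (metis det_mul mult_zero_left)
  then show ?thesis
    using psd_matrix_det_nonneg[OF matrix_sqrt_works(1)[OF psd]] by (simp add: Mmat_def)
qed

subsection \<open>Homogeneous monotone systems\<close>

lemma bounded_functions_convergent_subsequence:
  fixes u :: "nat \<Rightarrow> 'n \<Rightarrow> real"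
  assumes "finite N" "\<And>n z. z \<in> N \<Longrightarrow> \<bar>u n z\<bar> \<le> B"
  shows "\<exists>r l. strict_mono (r::nat \<Rightarrow> nat) \<and> (\<forall>z\<in>N. (\<lambda>n. u (r n) z) \<longlonglongrightarrow> l z)"
  using assms
proof (induction N rule: finite_induct)
  case empty
  show ?case by (rule exI[of _ id]) (auto simp: strict_mono_def)
next
  case (insert x N)
  then obtain r l where r: "strict_mono r" "\<And>z. z \<in> N \<Longrightarrow> (\<lambda>n. u (r n) z) \<longlonglongrightarrow> l z"
    by force
  have "bounded (range (\<lambda>n. u (r n) x))"
    using insert.prems[of x] by (intro boundedI[of _ B]) auto
  then obtain a s where s: "strict_mono (s::nat \<Rightarrow> nat)" "((\<lambda>n. u (r n) x) \<circ> s) \<longlonglongrightarrow> a"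
    using bounded_imp_convergent_subsequence by blast
  have "(\<lambda>n. u ((r \<circ> s) n) z) \<longlonglongrightarrow> (l(x := a)) z" if "z \<in> insert x N" for z
    using that s LIMSEQ_subseq_LIMSEQ[OF r(2) s(1)] by (cases "z = x") (auto simp: o_def)
  then show ?case
    using strict_mono_o[OF r(1) s(1)] by blast
qed

text \<open>The sum of the differences over N dominates their maximum and tends to 0 termwise. With
  d = 0 the hypothesis on F says that only values on N matter, so convergence on N suffices.\<close>

lemma tendsto_sup_Lipschitz:
  fixes F :: "('n \<Rightarrow> real) \<Rightarrow> real" and u :: "nat \<Rightarrow> 'n \<Rightarrow> real"
  assumes N: "finite N" and lim: "\<And>y. y \<in> N \<Longrightarrow> (\<lambda>n. u n y) \<longlonglongrightarrow> l y"
    and lip: "\<And>u v d. (\<And>y. y \<in> N \<Longrightarrow> \<bar>u y - v y\<bar> \<le> d) \<Longrightarrow> 0 \<le> d \<Longrightarrow> \<bar>F u - F v\<bar> \<le> K * d"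
  shows "(\<lambda>n. F (u n)) \<longlonglongrightarrow> F l"
proof -
  have bound: "norm (F (u n) - F l) \<le> K * (\<Sum>y\<in>N. \<bar>u n y - l y\<bar>)" for n
    unfolding real_norm_def
  proof (rule lip)
    show "\<bar>u n y - l y\<bar> \<le> (\<Sum>y\<in>N. \<bar>u n y - l y\<bar>)" if "y \<in> N" for y
      by (rule member_le_sum[of y N "\<lambda>y. \<bar>u n y - l y\<bar>"]) (auto simp: that N)
  qed (simp add: sum_nonneg)
  have "(\<lambda>n. K * (\<Sum>y\<in>N. \<bar>u n y - l y\<bar>)) \<longlonglongrightarrow> K * (\<Sum>y\<in>N. \<bar>l y - l y\<bar>)"
    by (intro tendsto_intros lim)
  then have "(\<lambda>n. K * (\<Sum>y\<in>N. \<bar>u n y - l y\<bar>)) \<longlonglongrightarrow> 0" by simp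
  then have "(\<lambda>n. F (u n) - F l) \<longlonglongrightarrow> 0"
    by (rule Lim_null_comparison[OF always_eventually[OF allI[OF bound]]])
  then show ?thesis by (rule LIM_zero_cancel)
qed

text \<open>Banach's iteration for q S. The maximum over N is only a pseudometric on total
  functions, so the fixed-point equation is claimed on N alone.\<close>

lemma nonexpansive_scaled_fixpoint:
  fixes S :: "('n \<Rightarrow> real) \<Rightarrow> 'n \<Rightarrow> real"
  assumes N: "finite N" and q: "0 \<le> q" "q < 1"
    and nonexp: "\<And>u v d z. (\<And>y. y \<in> N \<Longrightarrow> \<bar>u y - v y\<bar> \<le> d) \<Longrightarrow> 0 \<le> d \<Longrightarrow> z \<in> N
      \<Longrightarrow> \<bar>S u z - S v z\<bar> \<le> d"
  shows "\<exists>u. \<forall>z\<in>N. u z = q * S u z"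
proof -
  define U where "U n = ((\<lambda>u z. q * S u z) ^^ n) (\<lambda>_. 0)" for n
  have U0: "U 0 z = 0" and USuc: "U (Suc n) z = q * S (U n) z" for n z
    by (simp_all add: U_def)
  define C where "C = (\<Sum>z\<in>N. \<bar>U 1 z\<bar>)"
  have C: "0 \<le> C" by (simp add: C_def sum_nonneg)
  have step: "\<bar>U (Suc n) z - U n z\<bar> \<le> C * q ^ n" if "z \<in> N" for n z
    using that
  proof (induction n arbitrary: z)
    case 0
    then show ?case
      using member_le_sum[of z N "\<lambda>z. \<bar>U 1 z\<bar>"] N by (simp add: U0 C_def)
  next
    case (Suc n)
    have "\<bar>S (U (Suc n)) z - S (U n) z\<bar> \<le> C * q ^ n"
      using Suc C q by (intro nonexp) auto
    then have "q * \<bar>S (U (Suc n)) z - S (U n) z\<bar> \<le> q * (C * q ^ n)"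
      using q(1) by (rule mult_left_mono)
    moreover have "\<bar>U (Suc (Suc n)) z - U (Suc n) z\<bar> = q * \<bar>S (U (Suc n)) z - S (U n) z\<bar>"
      by (simp only: USuc right_diff_distrib[symmetric] abs_mult) (simp add: q)
    ultimately show ?case by (simp add: mult_ac)
  qed
  have "\<exists>l. (\<lambda>n. U n z) \<longlonglongrightarrow> l" if z: "z \<in> N" for z
  proof -
    have "summable (\<lambda>n. U (Suc n) z - U n z)"
      by (rule summable_comparison_test'[of "\<lambda>n. C * q ^ n"])
         (use q step[OF z] in \<open>auto intro!: summable_mult summable_geometric\<close>)
    moreover have "(\<Sum>i<n. U (Suc i) z - U i z) = U n z" for n
      by (induction n) (auto simp: U0)
    ultimately show ?thesis using summable_LIMSEQ by fastforce
  qed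
  then obtain l where l: "\<And>z. z \<in> N \<Longrightarrow> (\<lambda>n. U n z) \<longlonglongrightarrow> l z" by metis
  have "l z = q * S l z" if z: "z \<in> N" for z
  proof (rule LIMSEQ_unique)
    show "(\<lambda>n. U (Suc n) z) \<longlonglongrightarrow> l z" using l[OF z] by (rule LIMSEQ_Suc)
    have "(\<lambda>n. S (U n) z) \<longlonglongrightarrow> S l z"
      by (rule tendsto_sup_Lipschitz[OF N l, where K = 1]) (use nonexp z in auto)
    then show "(\<lambda>n. U (Suc n) z) \<longlonglongrightarrow> q * S l z"
      unfolding USuc by (intro tendsto_intros)
  qed
  then show ?thesis by blast
qed

text \<open>The step \<open>\<tau> z = 1 / K z\<close> makes \<open>S u = u + \<tau> (F u - f)\<close> nonexpansive in the maximum norm.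
  The fixed points \<open>u\<^sub>n\<close> of \<open>q\<^sub>n S\<close>, \<open>q\<^sub>n \<rightarrow> 1\<close>, may be unbounded, so one passes to the limit
  \<open>(v, t)\<close> of \<open>t\<^sub>n (u\<^sub>n, 1)\<close> with \<open>t\<^sub>n = 1 / (1 + \<parallel>u\<^sub>n\<parallel>)\<close>. Then \<open>F v = t f\<close>; here \<open>t = 0\<close> is
  impossible, since \<open>\<parallel>v\<parallel> = 1 - t\<close> while \<open>F v = 0\<close> forces \<open>v = 0\<close>.\<close>

lemma homogeneous_monotone_system_solvable:
  fixes F :: "('n \<Rightarrow> real) \<Rightarrow> 'n \<Rightarrow> real" and f :: "'n \<Rightarrow> real"
  assumes N: "finite N"
    and mono: "\<And>u v z. z \<in> N \<Longrightarrow> v z \<le> u z \<Longrightarrow> (\<And>y. y \<in> N \<Longrightarrow> u y - v y \<le> u z - v z)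
      \<Longrightarrow> F u z \<le> F v z"
    and strict: "\<And>u v y. y \<in> N \<Longrightarrow> v y < u y \<Longrightarrow> \<exists>z\<in>N. F u z < F v z"
    and hom: "\<And>t u z. z \<in> N \<Longrightarrow> 0 \<le> t \<Longrightarrow> F (\<lambda>y. t * u y) z = t * F u z"
    and lip: "\<And>u v d z. z \<in> N \<Longrightarrow> (\<And>y. y \<in> N \<Longrightarrow> \<bar>u y - v y\<bar> \<le> d) \<Longrightarrow> 0 \<le> d
      \<Longrightarrow> \<bar>F u z - F v z\<bar> \<le> K z * d"
    and K: "\<And>z. z \<in> N \<Longrightarrow> 0 < K z"
  shows "\<exists>u. \<forall>z\<in>N. F u z = f z"
proof -
  define S where "S u z = u z + (F u z - f z) / K z" for u z
  have oneside: "S u z \<le> S v z + d"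
    if d: "\<And>y. y \<in> N \<Longrightarrow> \<bar>u y - v y\<bar> \<le> d" "0 \<le> d" and z: "z \<in> N" for u v d z
  proof -
    define c where "c = v z + d - u z"
    have c: "0 \<le> c" using d(1)[OF z] by (simp add: c_def)
    \<comment> \<open>Raise u at z alone until u' - v attains its maximum d over N there, so that
      \<open>mono\<close> applies. The rise c costs at most \<open>K z * c\<close> in F, and the
      step 1 / K z turns this into c.\<close>
    define u' where "u' = u(z := v z + d)"
    have "F u' z \<le> F v z"
      by (rule mono[OF z]) (use d in \<open>auto simp: u'_def abs_le_iff\<close>)
    moreover have "\<bar>F u z - F u' z\<bar> \<le> K z * c"
      by (rule lip[OF z _ c]) (use c in \<open>auto simp: u'_def c_def\<close>)
    ultimately have "F u z - f z \<le> K z * c + (F v z - f z)" by simp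
    then have "(F u z - f z) / K z \<le> (K z * c + (F v z - f z)) / K z"
      using K[OF z] by (simp add: divide_right_mono)
    also have "\<dots> = c + (F v z - f z) / K z"
      using K[OF z] by (simp add: add_divide_distrib)
    finally show ?thesis by (simp add: S_def c_def)
  qed
  have nonexp: "\<bar>S u z - S v z\<bar> \<le> d"
    if "\<And>y. y \<in> N \<Longrightarrow> \<bar>u y - v y\<bar> \<le> d" "0 \<le> d" "z \<in> N" for u v d z
    using oneside[of u v d z] oneside[of v u d z] that by (fastforce simp: abs_minus_commute)
  define q where "q n = 1 - 1 / real (n + 2)" for n
  have q: "0 \<le> q n" "q n < 1" for n by (auto simp: q_def)
  have qlim: "q \<longlonglongrightarrow> 1"
  proof -
    have "(\<lambda>n. 1 - 1 / real (n + 2)) \<longlonglongrightarrow> 1 - 0"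
      by (intro tendsto_intros LIMSEQ_ignore_initial_segment lim_const_over_n)
    then show ?thesis by (simp add: q_def[abs_def])
  qed
  have "\<exists>u. \<forall>z\<in>N. u z = q n * S u z" for n
    by (rule nonexpansive_scaled_fixpoint[OF N q nonexp])
  then obtain u where u: "\<And>n z. z \<in> N \<Longrightarrow> u n z = q n * S (u n) z" by metis
  define m where "m n = (\<Sum>z\<in>N. \<bar>u n z\<bar>)" for n
  have m: "0 \<le> m n" for n by (simp add: m_def sum_nonneg)
  \<comment> \<open>With this factor the pairs (v n, t n) lie on the unit sphere of the l1 norm, so
    their limit cannot be (0, 0).\<close>
  define t where "t n = 1 / (1 + m n)" for n
  have t: "0 < t n" "t n \<le> 1" "t n * m n = 1 - t n" for n
    using m[of n] by (auto simp: t_def field_simps)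
  define v where "v n z = t n * u n z" for n z
  have sum_v: "(\<Sum>z\<in>N. \<bar>v n z\<bar>) = 1 - t n" for n
    using t(1)[of n] t(3)[of n] by (simp add: v_def abs_mult sum_distrib_left m_def)
  have fix_v: "v n z = q n * (v n z + (F (v n) z - t n * f z) / K z)" if z: "z \<in> N" for n z
  proof -
    have "F (v n) z = t n * F (u n) z"
      using hom[OF z, of "t n" "u n"] t(1)[of n] by (simp add: v_def[abs_def])
    moreover have "v n z = t n * (q n * S (u n) z)"
      using u[OF z, of n] by (simp add: v_def)
    ultimately show ?thesis
      by (simp add: S_def v_def algebra_simps diff_divide_distrib)
  qed
  have "\<bar>v n z\<bar> \<le> 1" if "z \<in> N" for n z
    using member_le_sum[of z N "\<lambda>z. \<bar>v n z\<bar>"] N that sum_v[of n] t(1)[of n] by simp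
  then obtain r l where r: "strict_mono (r::nat\<Rightarrow>nat)" "\<And>z. z \<in> N \<Longrightarrow> (\<lambda>n. v (r n) z) \<longlonglongrightarrow> l z"
    using bounded_functions_convergent_subsequence[OF N, of v 1] by blast
  define t\<^sub>0 where "t\<^sub>0 = 1 - (\<Sum>z\<in>N. \<bar>l z\<bar>)"
  have tlim: "(\<lambda>n. t (r n)) \<longlonglongrightarrow> t\<^sub>0"
  proof -
    have "(\<lambda>n. 1 - (\<Sum>z\<in>N. \<bar>v (r n) z\<bar>)) \<longlonglongrightarrow> t\<^sub>0"
      unfolding t\<^sub>0_def by (intro tendsto_intros r)
    then show ?thesis by (simp add: sum_v)
  qed
  have t0: "0 \<le> t\<^sub>0"
    using LIMSEQ_le_const[OF tlim, of 0] t(1) less_imp_le by blast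
  have Fl: "F l z = t\<^sub>0 * f z" if z: "z \<in> N" for z
  proof -
    have Flim: "(\<lambda>n. F (v (r n)) z) \<longlonglongrightarrow> F l z"
      by (rule tendsto_sup_Lipschitz[OF N r(2), where K = "K z"]) (use lip z in auto)
    have qr: "(\<lambda>n. q (r n)) \<longlonglongrightarrow> 1"
      using LIMSEQ_subseq_LIMSEQ[OF qlim r(1)] by (simp add: o_def)
    have "(\<lambda>n. q (r n) * (v (r n) z + (F (v (r n)) z - t (r n) * f z) / K z))
        \<longlonglongrightarrow> 1 * (l z + (F l z - t\<^sub>0 * f z) / K z)"
      using K[OF z] by (intro tendsto_intros qr r(2) z Flim tlim) auto
    then have "(\<lambda>n. v (r n) z) \<longlonglongrightarrow> 1 * (l z + (F l z - t\<^sub>0 * f z) / K z)"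
      using fix_v[OF z] by simp
    from LIMSEQ_unique[OF this r(2)[OF z]] show ?thesis
      using K[OF z] by simp
  qed
  have F0: "F (\<lambda>_. 0) z = 0" if "z \<in> N" for z
    using hom[OF that, of 0 "\<lambda>_. 0"] by simp
  have "t\<^sub>0 \<noteq> 0"
  proof
    assume *: "t\<^sub>0 = 0"
    have "l y = 0" if y: "y \<in> N" for y
      using strict[OF y, of "\<lambda>_. 0" l] strict[OF y, of l "\<lambda>_. 0"] Fl F0 * by fastforce
    then have "t\<^sub>0 = 1" by (simp add: t\<^sub>0_def)
    then show False using * by simp
  qed
  then have "F (\<lambda>y. (1 / t\<^sub>0) * l y) z = f z" if "z \<in> N" for z
    using hom[OF that, of "1 / t\<^sub>0" l] t0 Fl[OF that] by simp
  then show ?thesis by blast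
qed

subsection \<open>Barycentric coordinates\<close>

definition full_simplex :: "(real^'d::finite) set \<Rightarrow> bool" where
  "full_simplex K \<longleftrightarrow> finite K \<and> card K = CARD('d) + 1 \<and> \<not> affine_dependent K"

text \<open>The signed distance to the facet opposite v divided by the height of v. This form is
  affine on the whole space, and its gradient is a multiple of the normal that enters
  \<open>dihedral_angle\<close>; \<open>barycentric_vertex\<close> shows that it is the usual
  coordinate.\<close>

definition barycentric :: "(real^'d::finite) set \<Rightarrow> real^'d \<Rightarrow> real^'d \<Rightarrow> real" where
  "barycentric K v x =
     (x - closest_point (affine hull (K - {v})) v) \<bullet> facet_normal K v / (norm (facet_normal K v))\<^sup>2"

definition barycentric_grad :: "(real^'d::finite) set \<Rightarrow> real^'d \<Rightarrow> real^'d" where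
  "barycentric_grad K v = facet_normal K v /\<^sub>R (norm (facet_normal K v))\<^sup>2"

lemma barycentric_diff:
  "barycentric K v x - barycentric K v y = barycentric_grad K v \<bullet> (x - y)"
  by (simp add: barycentric_def barycentric_grad_def inner_diff_left inner_diff_right
      inner_commute diff_divide_distrib[symmetric] divide_inverse algebra_simps)

lemma barycentric_affine: "barycentric K v x = barycentric_grad K v \<bullet> x + barycentric K v 0"
  using barycentric_diff[of K v x 0] by simp

lemma full_simplex_facet_nonempty:
  fixes K :: "(real^'d::finite) set"
  assumes "full_simplex K"
  shows "K - {v} \<noteq> {}"
proof
  assume "K - {v} = {}"
  then have "card K \<le> card {v}" by (intro card_mono) auto
  then show False using assms by (simp add: full_simplex_def)
qed

text \<open>The affine hull contains x and its reflection in the closest point, so the variational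
  inequality of the projection holds with both signs.\<close>

lemma facet_normal_orthogonal:
  assumes "full_simplex K" and x: "x \<in> affine hull (K - {v})"
  shows "(x - closest_point (affine hull (K - {v})) v) \<bullet> facet_normal K v = 0"
proof -
  let ?H = "affine hull (K - {v})"
  let ?p = "closest_point ?H v"
  have p: "?p \<in> ?H"
    using full_simplex_facet_nonempty[OF assms(1)] by (intro closest_point_in_set) auto
  have "2 *\<^sub>R ?p + (- 1) *\<^sub>R x \<in> ?H"
    by (rule mem_affine[OF affine_affine_hull p x]) simp
  then have "(v - ?p) \<bullet> ((2 *\<^sub>R ?p + (- 1) *\<^sub>R x) - ?p) \<le> 0"
    by (intro closest_point_dot) (auto simp: affine_imp_convex)
  moreover have "(v - ?p) \<bullet> (x - ?p) \<le> 0"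
    using x by (intro closest_point_dot) (auto simp: affine_imp_convex)
  ultimately have "(v - ?p) \<bullet> (x - ?p) = 0" by (simp add: inner_diff_right)
  then show ?thesis by (simp add: facet_normal_def inner_commute)
qed

lemma facet_normal_nonzero:
  assumes "full_simplex K" "v \<in> K"
  shows "facet_normal K v \<noteq> 0"
proof
  assume "facet_normal K v = 0"
  then have "v = closest_point (affine hull (K - {v})) v" by (simp add: facet_normal_def)
  moreover have "closest_point (affine hull (K - {v})) v \<in> affine hull (K - {v})"
    using full_simplex_facet_nonempty[OF assms(1)] by (intro closest_point_in_set) auto
  ultimately show False
    using assms by (metis affine_dependent_def full_simplex_def)
qed

lemma barycentric_vertex:
  assumes "full_simplex K" "v \<in> K" "w \<in> K"
  shows "barycentric K v w = (if w = v then 1 else 0)"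
proof (cases "w = v")
  case True
  then show ?thesis
    using facet_normal_nonzero[OF assms(1,2)]
    by (simp add: barycentric_def facet_normal_def power2_norm_eq_inner)
next
  case False
  then have "w \<in> affine hull (K - {v})" using assms by (simp add: hull_inc)
  then show ?thesis
    using False facet_normal_orthogonal[OF assms(1), of w v] by (simp add: barycentric_def)
qed

lemma affine_function_sum:
  fixes a :: "'a::real_inner"
  assumes "sum u S = 1"
  shows "a \<bullet> (\<Sum>w\<in>S. u w *\<^sub>R w) + b = (\<Sum>w\<in>S. u w * (a \<bullet> w + b))"
  using assms by (simp add: inner_sum_right distrib_left sum.distrib sum_distrib_right[symmetric])

text \<open>Stated for faces J so that it applies to the common face of two neighbouring
  simplices.\<close>

lemma barycentric_sum:
  assumes K: "full_simplex K" and J: "J \<subseteq> K" and u: "sum u J = 1" and v: "v \<in> K"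
  shows "barycentric K v (\<Sum>w\<in>J. u w *\<^sub>R w) = (if v \<in> J then u v else 0)"
proof -
  have fin: "finite J" using K J by (auto simp: full_simplex_def intro: finite_subset)
  have "barycentric K v (\<Sum>w\<in>J. u w *\<^sub>R w) = (\<Sum>w\<in>J. u w * barycentric K v w)"
    using affine_function_sum[OF u, of "barycentric_grad K v" "barycentric K v 0"]
    by (simp only: barycentric_affine[symmetric])
  also have "\<dots> = (\<Sum>w\<in>J. if w = v then u w else 0)"
    using J by (intro sum.cong refl) (auto simp: barycentric_vertex[OF K v])
  finally show ?thesis using fin by (simp add: sum.delta')
qed

text \<open>The d + 1 affinely independent vertices span the whole space affinely, so this holds at
  every x and not only inside the simplex. The partition of unity and the expansion of x itself are
  the constant and the linear case.\<close>

lemma affine_barycentric_expansion: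
  fixes K :: "(real^'d::finite) set"
  assumes K: "full_simplex K"
  shows "a \<bullet> x + b = (\<Sum>v\<in>K. (a \<bullet> v + b) * barycentric K v x)"
proof -
  have "affine hull K = UNIV"
    using K by (intro affine_independent_span_eq) (auto simp: full_simplex_def)
  then have "x \<in> affine hull K" by simp
  then obtain u where u: "sum u K = 1" "x = (\<Sum>w\<in>K. u w *\<^sub>R w)"
    using K affine_hull_finite[of K] by (auto simp: full_simplex_def)
  have bary: "barycentric K v x = u v" if "v \<in> K" for v
    using barycentric_sum[OF K order_refl u(1) that] that by (simp only: u(2)[symmetric] if_True)
  have "a \<bullet> x + b = (\<Sum>w\<in>K. u w * (a \<bullet> w + b))"
    using affine_function_sum[OF u(1), of a b] by (simp only: u(2)[symmetric])
  also have "\<dots> = (\<Sum>v\<in>K. (a \<bullet> v + b) * barycentric K v x)"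
    by (rule sum.cong) (simp_all add: bary)
  finally show ?thesis .
qed

lemma sum_barycentric: "full_simplex K \<Longrightarrow> (\<Sum>v\<in>K. barycentric K v x) = 1"
  using affine_barycentric_expansion[of K 0 x 1] by simp

lemma barycentric_expansion:
  assumes "full_simplex K"
  shows "(\<Sum>v\<in>K. barycentric K v x *\<^sub>R v) = x"
proof -
  have "a \<bullet> (\<Sum>v\<in>K. barycentric K v x *\<^sub>R v) = a \<bullet> x" for a
    using affine_barycentric_expansion[OF assms, of a x 0]
    by (simp add: inner_sum_right mult.commute)
  then show ?thesis using vector_eq_ldot by blast
qed

text \<open>This is the gradient of the constant function 1.\<close>

lemma sum_barycentric_grad:
  assumes "full_simplex K"
  shows "(\<Sum>v\<in>K. barycentric_grad K v) = 0"
proof -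
  have "(\<Sum>v\<in>K. barycentric_grad K v) \<bullet> x = 0" for x
    using sum_barycentric[OF assms, of x] sum_barycentric[OF assms, of 0]
    by (simp add: inner_sum_left barycentric_diff[of K _ x 0, simplified, symmetric] sum_subtractf)
  then show ?thesis by (metis inner_eq_zero_iff)
qed

lemma barycentric_nonneg:
  assumes "full_simplex K" "x \<in> convex hull K" "v \<in> K"
  shows "0 \<le> barycentric K v x"
proof -
  obtain u where "\<forall>w\<in>K. 0 \<le> u w" "sum u K = 1" "x = (\<Sum>w\<in>K. u w *\<^sub>R w)"
    using assms convex_hull_finite[of K] by (auto simp: full_simplex_def)
  then show ?thesis using barycentric_sum[OF assms(1) order_refl _ assms(3)] assms(3) by auto
qed

text \<open>The normals point inward, so the dihedral angle and the angle between the normals add up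
  to pi; one is at most pi / 2 exactly if the other is at least pi / 2.\<close>

lemma barycentric_grad_acute:
  assumes T: "weakly_acute T" "K \<in> T" and K: "full_simplex K" and vw: "v \<in> K" "w \<in> K" "v \<noteq> w"
  shows "barycentric_grad K v \<bullet> barycentric_grad K w \<le> 0"
proof -
  let ?a = "facet_normal K v" and ?b = "facet_normal K w"
  let ?c = "(?a \<bullet> ?b) / (norm ?a * norm ?b)"
  have nz: "0 < norm ?a" "0 < norm ?b" using facet_normal_nonzero[OF K] vw by auto
  have c1: "\<bar>?c\<bar> \<le> 1"
    using Cauchy_Schwarz_ineq2[of ?a ?b] nz by (simp add: abs_mult divide_le_eq)
  have "pi / 2 \<le> arccos ?c"
    using T vw by (auto simp: weakly_acute_def dihedral_angle_def)
  moreover have "arccos ?c < arccos 0" if "0 < ?c"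
    using that c1 by (intro arccos_less_arccos) linarith+
  ultimately have "\<not> 0 < ?c" by fastforce
  then have "?a \<bullet> ?b \<le> 0" by (meson divide_pos_pos mult_pos_pos not_less nz)
  then show ?thesis by (simp add: barycentric_grad_def mult_nonneg_nonpos)
qed

subsection \<open>Piecewise linear functions on a convex mesh\<close>

text \<open>A convex combination of an interior point of a convex set, with positive weight, and a
  point of the closure is again interior. So a point of K off \<Omega> gives no weight to vertices
  in \<Omega>, and an interpolant with zero boundary values vanishes there.\<close>

lemma vanishes_on_convex_hull_compl:
  fixes \<Omega> :: "(real^'d::finite) set"
  assumes \<Omega>: "open \<Omega>" "convex \<Omega>" and K: "full_simplex K" "K \<subseteq> closure \<Omega>"
    and x: "x \<in> convex hull K" "x \<notin> \<Omega>" and v: "v \<in> K" "v \<in> \<Omega>"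
  shows "barycentric K v x = 0"
proof (rule ccontr)
  let ?e = "barycentric K v x"
  assume "?e \<noteq> 0"
  then have e: "0 < ?e" using barycentric_nonneg[OF K(1) x(1) v(1)] by simp
  have fin: "finite K" using K by (simp add: full_simplex_def)
  have s: "?e + (\<Sum>w\<in>K - {v}. barycentric K w x) = 1"
    using sum_barycentric[OF K(1), of x] v fin by (simp add: sum.remove)
  have "0 \<le> (\<Sum>w\<in>K - {v}. barycentric K w x)"
    by (intro sum_nonneg barycentric_nonneg[OF K(1) x(1)]) auto
  then have e1: "?e \<le> 1" using s by simp
  have ex: "x = ?e *\<^sub>R v + (\<Sum>w\<in>K - {v}. barycentric K w x *\<^sub>R w)"
    using barycentric_expansion[OF K(1), of x] v fin by (simp add: sum.remove)
  have int: "v \<in> interior \<Omega>" using v \<Omega> by (simp add: interior_open)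
  show False
  proof (cases "?e = 1")
    case True
    then have "(\<Sum>w\<in>K - {v}. barycentric K w x) = 0" using s by simp
    then have "barycentric K w x = 0" if "w \<in> K - {v}" for w
      using that fin barycentric_nonneg[OF K(1) x(1)] by (subst (asm) sum_nonneg_eq_0_iff) auto
    then have "x = v" using ex True by simp
    then show False using x v by simp
  next
    case False
    \<comment> \<open>The point where the ray from v through x meets the opposite facet.
      Renormalizing the weights needs \<open>?e \<noteq> 1\<close>, hence the case split.\<close>
    define y where "y = (\<Sum>w\<in>K - {v}. (barycentric K w x / (1 - ?e)) *\<^sub>R w)"
    have "y \<in> closure \<Omega>"
      unfolding y_def
    proof (rule convex_sum)
      show "(\<Sum>w\<in>K - {v}. barycentric K w x / (1 - ?e)) = 1"
        using s False by (simp add: sum_divide_distrib[symmetric])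
      show "0 \<le> barycentric K w x / (1 - ?e)" if "w \<in> K - {v}" for w
        using that e1 barycentric_nonneg[OF K(1) x(1)] by simp
    qed (use fin K(2) \<Omega> in auto)
    from mem_interior_closure_convex_shrink[OF \<Omega>(2) int this e e1]
    have "y - ?e *\<^sub>R (y - v) \<in> interior \<Omega>" .
    moreover have "y - ?e *\<^sub>R (y - v) = ?e *\<^sub>R v + (1 - ?e) *\<^sub>R y"
      by (simp add: algebra_simps)
    moreover have "(1 - ?e) *\<^sub>R y = (\<Sum>w\<in>K - {v}. barycentric K w x *\<^sub>R w)"
      using False by (simp add: y_def scaleR_sum_right)
    then have "?e *\<^sub>R v + (1 - ?e) *\<^sub>R y = x"
      by (intro trans[OF _ ex[symmetric]]) (simp only:)
    ultimately show False using x(2) interior_subset[of \<Omega>] by auto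
  qed
qed

section \<open>Nodal interpolation and the space \<open>V0\<close>\<close>

locale convex_mesh =
  fixes T :: "(real^'d::finite) set set" and \<Omega> :: "(real^'d) set"
  assumes open_dom: "open \<Omega>" and bounded_dom: "bounded \<Omega>" and convex_dom: "convex \<Omega>"
    and mesh: "simplicial_mesh T \<Omega>"
begin

abbreviation "nodes \<equiv> mesh_nodes T \<Omega>"

lemma finite_mesh: "finite T"
  using mesh by (simp add: simplicial_mesh_def)

lemma mesh_simplex: "K \<in> T \<Longrightarrow> full_simplex K"
  using mesh by (simp add: simplicial_mesh_def full_simplex_def)

lemma mesh_cover: "(\<Union>K\<in>T. convex hull K) = closure \<Omega>"
  using mesh unfolding simplicial_mesh_def by (elim conjE)

lemma mesh_conforming:
  assumes "K \<in> T" "K' \<in> T"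
  shows "convex hull K \<inter> convex hull K' = convex hull (K \<inter> K')"
proof -
  have "\<forall>K\<in>T. \<forall>K'\<in>T. convex hull K \<inter> convex hull K' = convex hull (K \<inter> K')"
    using mesh unfolding simplicial_mesh_def by (elim conjE)
  from bspec[OF bspec[OF this assms(1)] assms(2)] show ?thesis .
qed

lemma finite_simplex: "K \<in> T \<Longrightarrow> finite K"
  using mesh_simplex by (auto simp: full_simplex_def)

lemma finite_nodes: "finite nodes"
  using finite_mesh finite_simplex by (auto simp: mesh_nodes_def)

lemma simplex_subset_closure: "K \<in> T \<Longrightarrow> convex hull K \<subseteq> closure \<Omega>"
  using mesh_cover by blast

lemma vertices_subset_closure: "K \<in> T \<Longrightarrow> K \<subseteq> closure \<Omega>"
  by (rule order_trans[OF hull_subset simplex_subset_closure])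

lemma dom_covered:
  assumes "x \<in> \<Omega>"
  obtains K where "K \<in> T" "x \<in> convex hull K"
  using assms mesh_cover closure_subset by blast

lemma vertex_in_dom: "K \<in> T \<Longrightarrow> v \<in> K \<Longrightarrow> v \<in> \<Omega> \<Longrightarrow> v \<in> nodes"
  by (auto simp: mesh_nodes_def)

text \<open>A vertex off \<Omega> lies on the boundary; giving it the value 0 builds in the boundary
  condition, so c matters at interior nodes only.\<close>

definition local_interp :: "(real^'d \<Rightarrow> real) \<Rightarrow> (real^'d) set \<Rightarrow> real^'d \<Rightarrow> real" where
  "local_interp c K x = (\<Sum>v\<in>K. (if v \<in> \<Omega> then c v else 0) * barycentric K v x)"

text \<open>The choice of K is harmless by \<open>local_interp_consistent\<close>, and the value 0
  off \<Omega> is the extension by zero.\<close>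

definition interp :: "(real^'d \<Rightarrow> real) \<Rightarrow> real^'d \<Rightarrow> real" where
  "interp c x = (if x \<in> \<Omega> then local_interp c (SOME K. K \<in> T \<and> x \<in> convex hull K) x else 0)"

lemma local_interp_face:
  assumes K: "K \<in> T" and J: "J \<subseteq> K" and u: "sum u J = 1"
  shows "local_interp c K (\<Sum>w\<in>J. u w *\<^sub>R w) = (\<Sum>v\<in>J. (if v \<in> \<Omega> then c v else 0) * u v)"
proof -
  have "local_interp c K (\<Sum>w\<in>J. u w *\<^sub>R w)
      = (\<Sum>v\<in>K. if v \<in> J then (if v \<in> \<Omega> then c v else 0) * u v else 0)"
    unfolding local_interp_def
    by (intro sum.cong refl) (auto simp: barycentric_sum[OF mesh_simplex[OF K] J u])
  also have "\<dots> = (\<Sum>v\<in>J. (if v \<in> \<Omega> then c v else 0) * u v)"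
    using J finite_simplex[OF K] by (simp add: sum.inter_restrict[symmetric] Int_absorb1)
  finally show ?thesis .
qed

text \<open>By conformity x lies in the hull of the shared vertices, where both sides reduce to the
  same sum over these vertices.\<close>

lemma local_interp_consistent:
  assumes K: "K \<in> T" "K' \<in> T" and x: "x \<in> convex hull K" "x \<in> convex hull K'"
  shows "local_interp c K x = local_interp c K' x"
proof -
  have "x \<in> convex hull (K \<inter> K')" using mesh_conforming[OF K] x by blast
  then obtain u where "sum u (K \<inter> K') = 1" "x = (\<Sum>w\<in>K \<inter> K'. u w *\<^sub>R w)"
    using finite_simplex[OF K(1)] convex_hull_finite[of "K \<inter> K'"] by auto
  then show ?thesis
    using local_interp_face[OF K(1), of "K \<inter> K'" u c] local_interp_face[OF K(2), of "K \<inter> K'" u c]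
    by simp
qed

lemma interp_simplex:
  assumes K: "K \<in> T" "x \<in> convex hull K"
  shows "interp c x = local_interp c K x"
proof (cases "x \<in> \<Omega>")
  case True
  let ?K = "SOME K. K \<in> T \<and> x \<in> convex hull K"
  have "?K \<in> T \<and> x \<in> convex hull ?K" using someI[of "\<lambda>K. K \<in> T \<and> x \<in> convex hull K" K] K by blast
  then show ?thesis
    using True local_interp_consistent[of ?K K x c] K by (simp add: interp_def)
next
  case False
  have "local_interp c K x = 0"
    unfolding local_interp_def
    using vanishes_on_convex_hull_compl[OF open_dom convex_dom mesh_simplex[OF K(1)]
        vertices_subset_closure[OF K(1)] K(2) False]
    by (intro sum.neutral) auto
  then show ?thesis using False by (simp add: interp_def)
qed

lemma interp_outside: "x \<notin> \<Omega> \<Longrightarrow> interp c x = 0"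
  by (simp add: interp_def)

lemma local_interp_affine:
  "local_interp c K x = (\<Sum>v\<in>K. (if v \<in> \<Omega> then c v else 0) *\<^sub>R barycentric_grad K v) \<bullet> x
     + local_interp c K 0"
  unfolding local_interp_def
  by (subst barycentric_affine) (simp add: inner_sum_left distrib_left sum.distrib)

lemma continuous_interp: "continuous_on UNIV (interp c)"
proof -
  \<comment> \<open>\<open>None\<close> stands for the complement of \<Omega>. Together with the
    finitely many simplices it gives a finite closed cover of the space, as pasting
    requires.\<close>
  define D where "D i = (case i of None \<Rightarrow> - \<Omega> | Some K \<Rightarrow> convex hull K)" for i
  define g where "g i = (case i of None \<Rightarrow> (\<lambda>_. 0) | Some K \<Rightarrow> local_interp c K)" for i
  let ?I = "insert None (Some ` T)"
  have "continuous_map euclidean euclideanreal (interp c)"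
  proof (rule pasting_lemma_closed[where I = ?I and T = D and f = g])
    show "finite ?I" using finite_mesh by simp
    show "closedin euclidean (D i)" if "i \<in> ?I" for i
      using that open_dom finite_simplex
      by (auto simp: D_def closed_Compl compact_imp_closed finite_imp_compact_convex_hull)
    show "continuous_map (subtopology euclidean (D i)) euclideanreal (g i)" for i
    proof (cases i)
      case (Some K)
      have "continuous_on (D i) (local_interp c K)"
        by (subst local_interp_affine[abs_def]) (intro continuous_intros)
      then show ?thesis using Some by (simp add: g_def)
    qed (simp add: g_def)
    have Dg: "interp c x = g i x" if "i \<in> ?I" "x \<in> D i" for i x
      using that interp_simplex by (auto simp: D_def g_def interp_outside)
    show "g i x = g j x" if "i \<in> ?I" "j \<in> ?I" "x \<in> topspace euclidean \<inter> D i \<inter> D j" for i j x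
      using that Dg[of i x] Dg[of j x] by simp
    show "\<exists>j. j \<in> ?I \<and> x \<in> D j \<and> interp c x = g j x" for x
    proof (cases "x \<in> \<Omega>")
      case True
      then obtain K where K: "K \<in> T" "x \<in> convex hull K" by (rule dom_covered)
      have "Some K \<in> ?I" "x \<in> D (Some K)" using K by (auto simp: D_def)
      then show ?thesis using Dg by blast
    next
      case False
      have "None \<in> ?I" "x \<in> D None" using False by (auto simp: D_def)
      then show ?thesis using Dg by blast
    qed
  qed
  then show ?thesis by simp
qed

lemma interp_in_V0: "interp c \<in> V0 T \<Omega>"
proof -
  have "\<exists>a b. \<forall>x\<in>convex hull K. interp c x = a \<bullet> x + b" if "K \<in> T" for K
  proof (intro exI ballI)
    fix x assume "x \<in> convex hull K"
    show "interp c x = (\<Sum>v\<in>K. (if v \<in> \<Omega> then c v else 0) *\<^sub>R barycentric_grad K v) \<bullet> x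
        + local_interp c K 0"
      unfolding interp_simplex[OF that \<open>x \<in> convex hull K\<close>] by (rule local_interp_affine)
  qed
  then show ?thesis
    unfolding V0_def using continuous_interp interp_outside by auto
qed

lemma local_interp_vertex:
  assumes "K \<in> T" "v \<in> K" "v \<in> \<Omega>"
  shows "local_interp c K v = c v"
  using local_interp_face[OF assms(1), of "{v}" "\<lambda>_. 1" c] assms by simp

lemma interp_node:
  assumes "z \<in> nodes"
  shows "interp c z = c z"
proof -
  obtain K where "K \<in> T" "z \<in> K" "z \<in> \<Omega>" using assms by (auto simp: mesh_nodes_def)
  then show ?thesis
    using interp_simplex[of K z c] local_interp_vertex[of K z c] by (simp add: hull_inc)
qed

lemma V0_expansion:
  assumes w: "w \<in> V0 T \<Omega>" and K: "K \<in> T" "x \<in> convex hull K"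
  shows "w x = (\<Sum>v\<in>K. w v * barycentric K v x)"
proof -
  obtain a b where ab: "\<And>x. x \<in> convex hull K \<Longrightarrow> w x = a \<bullet> x + b"
    using w K(1) by (auto simp: V0_def)
  have "w x = (\<Sum>v\<in>K. (a \<bullet> v + b) * barycentric K v x)"
    unfolding ab[OF K(2)] by (rule affine_barycentric_expansion[OF mesh_simplex[OF K(1)]])
  also have "\<dots> = (\<Sum>v\<in>K. w v * barycentric K v x)"
    by (intro sum.cong refl) (simp add: ab hull_inc)
  finally show ?thesis .
qed

lemma V0_outside: "w \<in> V0 T \<Omega> \<Longrightarrow> x \<notin> \<Omega> \<Longrightarrow> w x = 0"
  by (simp add: V0_def)

text \<open>With \<open>interp_in_V0\<close> and \<open>interp_node\<close>, this identifies
  \<open>V0\<close> with the functions on the nodes and turns the scheme into a finite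
  system.\<close>

lemma interp_V0_eq:
  assumes w: "w \<in> V0 T \<Omega>" and c: "\<And>z. z \<in> nodes \<Longrightarrow> c z = w z"
  shows "interp c = w"
proof
  fix x
  show "interp c x = w x"
  proof (cases "x \<in> \<Omega>")
    case True
    then obtain K where K: "K \<in> T" "x \<in> convex hull K" by (rule dom_covered)
    have "local_interp c K x = (\<Sum>v\<in>K. w v * barycentric K v x)"
      unfolding local_interp_def
      by (intro sum.cong refl) (use V0_outside[OF w] c vertex_in_dom[OF K(1)] in auto)
    then show ?thesis using interp_simplex[OF K] V0_expansion[OF w K] by simp
  next
    case False
    then show ?thesis using V0_outside[OF w] by (simp add: interp_outside)
  qed
qed

lemma interp_linear: "interp (\<lambda>z. a * c z + b * e z) x = a * interp c x + b * interp e x"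
  unfolding interp_def local_interp_def
  by (auto simp: sum_distrib_left sum.distrib[symmetric] algebra_simps intro!: sum.cong)

lemma V0_linear:
  assumes "u \<in> V0 T \<Omega>" "v \<in> V0 T \<Omega>"
  shows "(\<lambda>x. a * u x + b * v x) \<in> V0 T \<Omega>"
proof -
  have "interp (\<lambda>x. a * u x + b * v x) = (\<lambda>x. a * u x + b * v x)"
    using interp_linear[of a u b v] interp_V0_eq[OF assms(1) refl] interp_V0_eq[OF assms(2) refl]
    by (intro ext) metis
  then show ?thesis using interp_in_V0 by metis
qed

lemma V0_diff: "u \<in> V0 T \<Omega> \<Longrightarrow> v \<in> V0 T \<Omega> \<Longrightarrow> (\<lambda>x. u x - v x) \<in> V0 T \<Omega>"
  using V0_linear[of u v 1 "-1"] by simp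

text \<open>Values are convex combinations of vertex values; \<open>0 \<le> m\<close> accounts for
  the zeros on the boundary and outside.\<close>

lemma V0_le:
  assumes w: "w \<in> V0 T \<Omega>" and m: "0 \<le> m" "\<And>z. z \<in> nodes \<Longrightarrow> w z \<le> m"
  shows "w x \<le> m"
proof (cases "x \<in> \<Omega>")
  case True
  then obtain K where K: "K \<in> T" "x \<in> convex hull K" by (rule dom_covered)
  have "w v \<le> m" if "v \<in> K" for v
    using that m vertex_in_dom[OF K(1) that] V0_outside[OF w, of v] by (cases "v \<in> \<Omega>") auto
  then have "w x \<le> (\<Sum>v\<in>K. m * barycentric K v x)"
    unfolding V0_expansion[OF w K]
    by (intro sum_mono mult_right_mono barycentric_nonneg[OF mesh_simplex[OF K(1)] K(2)]) auto
  also have "\<dots> = m"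
    using sum_barycentric[OF mesh_simplex[OF K(1)]] by (simp add: sum_distrib_left[symmetric])
  finally show ?thesis .
next
  case False
  then show ?thesis using V0_outside[OF w] m(1) by simp
qed

lemma V0_abs_le:
  assumes w: "w \<in> V0 T \<Omega>" and m: "0 \<le> m" "\<And>z. z \<in> nodes \<Longrightarrow> \<bar>w z\<bar> \<le> m"
  shows "\<bar>w x\<bar> \<le> m"
  using V0_le[OF w m(1), of x] V0_le[OF V0_linear[OF w w, of "-1" 0] m(1), of x] m(2)
  by (fastforce simp: abs_le_iff)

definition hat :: "real^'d \<Rightarrow> real^'d \<Rightarrow> real" where
  "hat z = interp (\<lambda>y. if y = z then 1 else 0)"

lemma hat_in_V0: "hat z \<in> V0 T \<Omega>"
  by (simp add: hat_def interp_in_V0)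

lemma hat_node: "y \<in> nodes \<Longrightarrow> hat z y = (if y = z then 1 else 0)"
  by (simp add: hat_def interp_node)

lemma hat_vertex:
  assumes "K \<in> T" "v \<in> K" "z \<in> nodes"
  shows "hat z v = (if v = z then 1 else 0)"
proof (cases "v \<in> \<Omega>")
  case True
  then show ?thesis using hat_node vertex_in_dom assms by simp
next
  case False
  then show ?thesis using V0_outside[OF hat_in_V0] assms by (auto simp: mesh_nodes_def)
qed

lemma hat_nonneg: "0 \<le> hat z x"
  using V0_le[OF V0_linear[OF hat_in_V0 hat_in_V0, of "-1" z 0 z], of 0 x] hat_node by auto

lemma nodal_basis_eq_hat:
  assumes z: "z \<in> nodes"
  shows "nodal_basis T \<Omega> z = hat z"
  unfolding nodal_basis_def
proof (rule the_equality)
  show "hat z \<in> V0 T \<Omega> \<and> hat z z = 1 \<and> (\<forall>z'\<in>nodes. z' \<noteq> z \<longrightarrow> hat z z' = 0)"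
    using z hat_in_V0 hat_node by simp
next
  fix \<phi> assume \<phi>: "\<phi> \<in> V0 T \<Omega> \<and> \<phi> z = 1 \<and> (\<forall>z'\<in>nodes. z' \<noteq> z \<longrightarrow> \<phi> z' = 0)"
  then show "\<phi> = hat z"
    unfolding hat_def by (intro interp_V0_eq[symmetric]) auto
qed

end

subsection \<open>The discrete Laplacian\<close>

context convex_mesh begin

text \<open>In the interior of K the affine formula holds in a full neighbourhood of x and thus
  determines the derivative.\<close>

lemma grad_V0:
  assumes w: "w \<in> V0 T \<Omega>" and K: "K \<in> T" and x: "x \<in> interior (convex hull K)"
  shows "grad w x = (\<Sum>v\<in>K. w v *\<^sub>R barycentric_grad K v)"
proof -
  let ?a = "\<Sum>v\<in>K. w v *\<^sub>R barycentric_grad K v"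
  let ?b = "\<Sum>v\<in>K. w v * barycentric K v 0"
  have eq: "?a \<bullet> y + ?b = w y" if "y \<in> interior (convex hull K)" for y
  proof -
    have "y \<in> convex hull K" using that interior_subset by blast
    from V0_expansion[OF w K this] show ?thesis
      by (subst (asm) barycentric_affine) (simp add: inner_sum_left distrib_left sum.distrib)
  qed
  have "((\<lambda>y. ?a \<bullet> y + ?b) has_derivative (\<lambda>y. ?a \<bullet> y)) (at x)"
    by (auto intro!: derivative_eq_intros)
  then have "(w has_derivative (\<lambda>y. ?a \<bullet> y)) (at x)"
    by (rule has_derivative_transform_within_open[OF _ open_interior x]) (rule eq)
  then have "frechet_derivative w (at x) = (\<lambda>y. ?a \<bullet> y)"
    by (rule frechet_derivative_at[symmetric])
  then show ?thesis
    by (simp add: grad_def vec_eq_iff inner_axis)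
qed

text \<open>Two distinct vertex sets of equal size d + 1 share at most d points, whose affine hull
  has empty interior.\<close>

lemma negligible_simplex_overlap:
  assumes K: "K \<in> T" "K' \<in> T" "K \<noteq> K'"
  shows "negligible (convex hull K \<inter> convex hull K')"
proof -
  have fin: "finite K" "finite K'" using K finite_simplex by auto
  have card: "card K = CARD('d) + 1" "card K' = CARD('d) + 1"
    using mesh_simplex[OF K(1)] mesh_simplex[OF K(2)] by (auto simp: full_simplex_def)
  have "card (K \<inter> K') < card K"
  proof (rule psubset_card_mono)
    show "K \<inter> K' \<subset> K"
      using K(3) card_subset_eq[OF fin(2), of K] card by auto
  qed (rule fin)
  then have "card (K \<inter> K') \<le> DIM(real^'d)" using card by simp
  then have "interior (affine hull (K \<inter> K')) = {}"
    using fin by (intro empty_interior_affine_hull) auto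
  then have "interior (convex hull (K \<inter> K')) = {}"
    using interior_mono[OF convex_hull_subset_affine_hull] by blast
  then show ?thesis
    using mesh_conforming[OF K(1,2)] by (simp add: negligible_convex_interior)
qed

abbreviation volume :: "(real^'d) set \<Rightarrow> real" where
  "volume K \<equiv> measure lebesgue (convex hull K)"

lemma volume_pos:
  assumes K: "K \<in> T"
  shows "0 < volume K"
proof -
  have "interior (convex hull K) \<noteq> {}"
    using mesh_simplex[OF K] by (subst interior_convex_hull_eq_empty) (auto simp: full_simplex_def)
  then have "\<not> negligible (convex hull K)" by (simp add: negligible_convex_interior)
  moreover have "convex hull K \<in> lmeasurable"
    using finite_simplex[OF K] by (intro lmeasurable_compact finite_imp_compact_convex_hull)
  ultimately show ?thesis
    using negligible_iff_measure zero_less_measure_iff by blast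
qed

text \<open>The gradients are constant inside each simplex. What is left is negligible: simplex
  boundaries, overlaps, and the boundary of \<Omega>, the latter by convexity.\<close>

lemma has_integral_grad_product:
  assumes w: "w \<in> V0 T \<Omega>" and u: "u \<in> V0 T \<Omega>"
  shows "((\<lambda>x. grad w x \<bullet> grad u x) has_integral
    (\<Sum>K\<in>T. volume K * ((\<Sum>v\<in>K. w v *\<^sub>R barycentric_grad K v) \<bullet> (\<Sum>v\<in>K. u v *\<^sub>R barycentric_grad K v)))) \<Omega>"
proof -
  let ?c = "\<lambda>K. (\<Sum>v\<in>K. w v *\<^sub>R barycentric_grad K v) \<bullet> (\<Sum>v\<in>K. u v *\<^sub>R barycentric_grad K v)"
  let ?f = "\<lambda>x. grad w x \<bullet> grad u x"
  have "(?f has_integral (\<Sum>K\<in>T. volume K * ?c K)) (\<Union>K\<in>T. convex hull K)"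
  proof (rule has_integral_UN[OF finite_mesh])
    fix K assume K: "K \<in> T"
    have "convex hull K \<in> lmeasurable"
      using finite_simplex[OF K] by (intro lmeasurable_compact finite_imp_compact_convex_hull)
    then have "((\<lambda>x. 1::real) has_integral volume K) (convex hull K)"
      by (metis lmeasure_integral integrable_integral integrable_on_const)
    then have const: "((\<lambda>x. 1 * ?c K) has_integral volume K * ?c K) (convex hull K)"
      by (rule has_integral_mult_left)
    show "(?f has_integral volume K * ?c K) (convex hull K)"
    proof (rule has_integral_spike[OF _ _ const])
      show "negligible (frontier (convex hull K))"
        by (simp add: negligible_convex_frontier)
      fix x assume "x \<in> convex hull K - frontier (convex hull K)"
      then have "x \<in> interior (convex hull K)"
        using closure_subset by (auto simp: frontier_def)
      then show "?f x = 1 * ?c K" by (simp add: grad_V0[OF w K] grad_V0[OF u K])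
    qed
  next
    show "pairwise (\<lambda>K K'. negligible (convex hull K \<inter> convex hull K')) T"
      using negligible_simplex_overlap by (simp add: pairwise_def)
  qed
  then have "(?f has_integral (\<Sum>K\<in>T. volume K * ?c K)) (closure \<Omega>)" by (simp add: mesh_cover)
  moreover have "negligible (closure \<Omega> - \<Omega>)"
    using negligible_convex_frontier[OF convex_dom] open_dom
    by (simp add: frontier_def interior_open)
  moreover have "\<Omega> - closure \<Omega> = {}" using closure_subset by blast
  ultimately show ?thesis
    by (subst has_integral_spike_set_eq[where T = "closure \<Omega>"])
       (auto intro: negligible_subset)
qed

definition mass :: "real^'d \<Rightarrow> real" where
  "mass z = integral \<Omega> (hat z)"

text \<open>A nonnegative continuous function with integral zero over a box vanishes on it, but the
  hat function is 1 at z. As it vanishes off \<Omega>, its integral can be taken over a box.\<close>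

lemma mass_pos:
  assumes z: "z \<in> nodes"
  shows "0 < mass z"
proof -
  have zO: "z \<in> \<Omega>" using z by (simp add: mesh_nodes_def)
  have cont: "continuous_on S (hat z)" for S
    using hat_in_V0[of z] continuous_on_subset by (auto simp: V0_def)
  obtain a where a: "\<Omega> \<subseteq> cbox (- a) a"
    using bounded_subset_cbox_symmetric[OF bounded_dom] by blast
  have restrict: "(\<lambda>x. if x \<in> \<Omega> then hat z x else 0) = hat z"
    using V0_outside[OF hat_in_V0] by auto
  have int: "hat z integrable_on cbox (- a) a" by (intro integrable_continuous cont)
  from integrable_integral[OF this]
  have "(hat z has_integral integral (cbox (- a) a) (hat z)) \<Omega>"
    by (simp only: has_integral_restrict[OF a, of "hat z", unfolded restrict])
  then have eq: "mass z = integral (cbox (- a) a) (hat z)"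
    unfolding mass_def by (rule integral_unique)
  have "0 \<le> mass z" unfolding eq by (intro integral_nonneg int hat_nonneg)
  moreover have "mass z \<noteq> 0"
  proof
    assume "mass z = 0"
    then have 0: "(hat z has_integral 0) (cbox (- a) a)"
      using int eq by (metis integrable_integral)
    have "\<Omega> \<subseteq> interior (cbox (- a) a)" using a open_dom by (rule interior_maximal)
    then have "box (- a) a \<noteq> {}" using zO by (auto simp: interior_cbox)
    from has_integral_0_cbox_imp_0[OF cont _ 0 this, of z] have "hat z z = 0"
      using a zO hat_nonneg by auto
    then show False using hat_node[OF z, of z] by simp
  qed
  ultimately show ?thesis by simp
qed

text \<open>For z in K, the constant value on K of the product of the gradients of w and of the hat
  function at z.\<close>

definition stiffness :: "(real^'d \<Rightarrow> real) \<Rightarrow> real^'d \<Rightarrow> (real^'d) set \<Rightarrow> real" where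
  "stiffness w z K = (\<Sum>v\<in>K. w v * (barycentric_grad K v \<bullet> barycentric_grad K z))"

lemma discrete_laplacian_eq:
  assumes w: "w \<in> V0 T \<Omega>" and z: "z \<in> nodes"
  shows "discrete_laplacian T \<Omega> w z
    = - (\<Sum>K\<in>{K\<in>T. z \<in> K}. volume K * stiffness w z K) / mass z"
proof -
  have hat_grad: "(\<Sum>v\<in>K. hat z v *\<^sub>R barycentric_grad K v)
      = (if z \<in> K then barycentric_grad K z else 0)" if K: "K \<in> T" for K
  proof -
    have "(\<Sum>v\<in>K. hat z v *\<^sub>R barycentric_grad K v)
        = (\<Sum>v\<in>K. if v = z then barycentric_grad K v else 0)"
      using hat_vertex[OF K _ z] by (intro sum.cong) auto
    then show ?thesis using finite_simplex[OF K] by (simp add: sum.delta')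
  qed
  have "integral \<Omega> (\<lambda>x. grad w x \<bullet> grad (hat z) x)
      = (\<Sum>K\<in>T. if z \<in> K then volume K * stiffness w z K else 0)"
    unfolding integral_unique[OF has_integral_grad_product[OF w hat_in_V0]]
    by (intro sum.cong refl) (simp add: hat_grad stiffness_def inner_sum_left)
  also have "\<dots> = (\<Sum>K\<in>{K\<in>T. z \<in> K}. volume K * stiffness w z K)"
    using finite_mesh by (simp add: sum.inter_filter)
  finally show ?thesis
    by (simp add: discrete_laplacian_def nodal_basis_eq_hat[OF z] mass_def)
qed

lemma stiffness_linear:
  "stiffness (\<lambda>x. a * u x + b * v x) z K = a * stiffness u z K + b * stiffness v z K"
  by (simp add: stiffness_def sum_distrib_left sum.distrib algebra_simps)

lemma discrete_laplacian_linear: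
  assumes "u \<in> V0 T \<Omega>" "v \<in> V0 T \<Omega>" "z \<in> nodes"
  shows "discrete_laplacian T \<Omega> (\<lambda>x. a * u x + b * v x) z
    = a * discrete_laplacian T \<Omega> u z + b * discrete_laplacian T \<Omega> v z"
  using mass_pos[OF assms(3)]
  by (simp add: discrete_laplacian_eq assms V0_linear stiffness_linear field_simps
      sum.distrib sum_distrib_left)

lemma discrete_laplacian_bound:
  assumes z: "z \<in> nodes"
  shows "\<exists>C\<ge>0. \<forall>w d. w \<in> V0 T \<Omega> \<longrightarrow> (\<forall>x. \<bar>w x\<bar> \<le> d) \<longrightarrow> \<bar>discrete_laplacian T \<Omega> w z\<bar> \<le> C * d"
proof -
  define C where "C = (\<Sum>K\<in>{K\<in>T. z \<in> K}. volume K *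
    (\<Sum>v\<in>K. \<bar>barycentric_grad K v \<bullet> barycentric_grad K z\<bar>)) / mass z"
  have "0 \<le> C"
    unfolding C_def using mass_pos[OF z]
    by (intro divide_nonneg_pos sum_nonneg mult_nonneg_nonneg) auto
  moreover have "\<bar>discrete_laplacian T \<Omega> w z\<bar> \<le> C * d"
    if w: "w \<in> V0 T \<Omega>" and d: "\<And>x. \<bar>w x\<bar> \<le> d" for w d
  proof -
    have st: "\<bar>stiffness w z K\<bar> \<le> (\<Sum>v\<in>K. \<bar>barycentric_grad K v \<bullet> barycentric_grad K z\<bar>) * d" for K
      unfolding stiffness_def sum_distrib_right
      by (rule order_trans[OF sum_abs])
         (intro sum_mono, simp add: abs_mult mult.commute[of _ d] mult_right_mono d)
    have "\<bar>\<Sum>K\<in>{K\<in>T. z \<in> K}. volume K * stiffness w z K\<bar>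
        \<le> (\<Sum>K\<in>{K\<in>T. z \<in> K}. volume K *
            ((\<Sum>v\<in>K. \<bar>barycentric_grad K v \<bullet> barycentric_grad K z\<bar>) * d))"
      by (rule order_trans[OF sum_abs]) (intro sum_mono, simp add: abs_mult mult_left_mono st)
    then have "\<bar>discrete_laplacian T \<Omega> w z\<bar> \<le> (\<Sum>K\<in>{K\<in>T. z \<in> K}. volume K *
            ((\<Sum>v\<in>K. \<bar>barycentric_grad K v \<bullet> barycentric_grad K z\<bar>) * d)) / mass z"
      using mass_pos[OF z] by (simp add: discrete_laplacian_eq[OF w z] divide_right_mono)
    then show ?thesis by (simp add: C_def sum_distrib_right mult.assoc)
  qed
  ultimately show ?thesis by blast
qed

text \<open>The gradients of the barycentric coordinates sum to zero, so \<open>w z\<close> may be subtracted.\<close>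

lemma stiffness_shift:
  assumes K: "K \<in> T" "z \<in> K"
  shows "stiffness w z K
    = (\<Sum>v\<in>K - {z}. (w v - w z) * (barycentric_grad K v \<bullet> barycentric_grad K z))"
proof -
  have "(\<Sum>v\<in>K. barycentric_grad K v \<bullet> barycentric_grad K z) = 0"
    using sum_barycentric_grad[OF mesh_simplex[OF K(1)]] by (simp add: inner_sum_left[symmetric])
  then have "stiffness w z K
      = (\<Sum>v\<in>K. (w v - w z) * (barycentric_grad K v \<bullet> barycentric_grad K z))"
    by (simp add: stiffness_def left_diff_distrib sum_subtractf sum_distrib_left[symmetric])
  then show ?thesis using K finite_simplex[OF K(1)] by (simp add: sum.remove)
qed

end

section \<open>Maximum principles and solvability on weakly acute meshes\<close>

locale acute_mesh = convex_mesh T \<Omega>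
  for T :: "(real^'d::finite) set set" and \<Omega> :: "(real^'d) set" +
  assumes acute: "weakly_acute T"
begin

lemma stiffness_term_nonneg:
  assumes "K \<in> T" "z \<in> K" "v \<in> K - {z}" "w v \<le> w z"
  shows "0 \<le> (w v - w z) * (barycentric_grad K v \<bullet> barycentric_grad K z)"
  using assms barycentric_grad_acute[OF acute assms(1) mesh_simplex[OF assms(1)], of v z]
  by (intro mult_nonpos_nonpos) auto

lemma stiffness_nonneg:
  assumes "K \<in> T" "z \<in> K" "\<And>x. w x \<le> w z"
  shows "0 \<le> stiffness w z K"
  unfolding stiffness_shift[OF assms(1,2)]
  by (intro sum_nonneg stiffness_term_nonneg assms)

lemma discrete_laplacian_max_nonpos:
  assumes w: "w \<in> V0 T \<Omega>" and z: "z \<in> nodes" and max: "\<And>x. w x \<le> w z"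
  shows "discrete_laplacian T \<Omega> w z \<le> 0"
proof -
  have "0 \<le> (\<Sum>K\<in>{K\<in>T. z \<in> K}. volume K * stiffness w z K)"
    by (intro sum_nonneg mult_nonneg_nonneg stiffness_nonneg max) auto
  then show ?thesis using mass_pos[OF z] by (simp add: discrete_laplacian_eq[OF w z])
qed

text \<open>All stiffness terms at a maximum are nonnegative, being products of two nonpositive
  factors, so a nonnegative Laplacian forces each to vanish: a lower neighbour must be decoupled
  from z.\<close>

lemma discrete_laplacian_max_zero:
  assumes w: "w \<in> V0 T \<Omega>" and z: "z \<in> nodes" and max: "\<And>x. w x \<le> w z"
    and nonneg: "0 \<le> discrete_laplacian T \<Omega> w z"
    and K: "K \<in> T" "z \<in> K" "v \<in> K" "w v < w z"
  shows "barycentric_grad K v \<bullet> barycentric_grad K z = 0"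
proof -
  have vz: "v \<in> K - {z}" using K by auto
  have "(\<Sum>K\<in>{K\<in>T. z \<in> K}. volume K * stiffness w z K) \<le> 0"
    using nonneg mass_pos[OF z] by (auto simp: discrete_laplacian_eq[OF w z] divide_le_0_iff)
  moreover have nn: "0 \<le> volume K * stiffness w z K" if "K \<in> {K\<in>T. z \<in> K}" for K
    using that by (intro mult_nonneg_nonneg stiffness_nonneg max) auto
  ultimately have "(\<Sum>K\<in>{K\<in>T. z \<in> K}. volume K * stiffness w z K) = 0"
    by (intro antisym sum_nonneg)
  then have "volume K * stiffness w z K = 0"
    using sum_nonneg_eq_0_iff[of "{K\<in>T. z \<in> K}" "\<lambda>K. volume K * stiffness w z K"]
      nn K finite_mesh by auto
  then have "stiffness w z K = 0" using volume_pos[OF K(1)] by simp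
  then have "(w v - w z) * (barycentric_grad K v \<bullet> barycentric_grad K z) = 0"
    unfolding stiffness_shift[OF K(1,2)]
    using vz finite_simplex[OF K(1)] stiffness_term_nonneg[OF K(1,2)] max
    by (subst (asm) sum_nonneg_eq_0_iff) auto
  then show ?thesis using K by simp
qed

text \<open>If the Laplacian is nonnegative at all maximum points \<open>Z\<close>, the gradients belonging to
  \<open>K \<inter> Z\<close> and to \<open>K - Z\<close> are orthogonal in each simplex \<open>K\<close>. Both families have opposite sums,
  so \<open>\<Sum>\<^bsub>z \<in> K \<inter> Z\<^esub> \<lambda>\<^sub>z\<close> is constant on \<open>K\<close>, that is, \<open>K \<subseteq> Z\<close> or \<open>K \<inter> Z = {}\<close>. As the closure
  of \<open>\<Omega>\<close> is connected, \<open>Z\<close> then contains all vertices, including those on the boundary.\<close>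

lemma discrete_laplacian_strong_max:
  assumes w: "w \<in> V0 T \<Omega>" and y: "y \<in> nodes" "0 < w y"
  shows "\<exists>z\<in>nodes. (\<forall>x. w x \<le> w z) \<and> discrete_laplacian T \<Omega> w z < 0"
proof (rule ccontr)
  assume neg: "\<not> ?thesis"
  define m where "m = Max (w ` nodes)"
  have wy: "w x \<le> m" if "x \<in> nodes" for x
    unfolding m_def using that finite_nodes by (intro Max_ge) auto
  then have m: "0 < m" using y by fastforce
  have "m \<in> w ` nodes" unfolding m_def using finite_nodes y by (intro Max_in) auto
  then obtain z\<^sub>0 where z0: "z\<^sub>0 \<in> nodes" "w z\<^sub>0 = m" by auto
  have max: "w x \<le> m" for x by (rule V0_le[OF w]) (use m wy in auto)
  define Z where "Z = {z\<in>nodes. w z = m}"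
  have Z_dom: "Z \<subseteq> \<Omega>" by (auto simp: Z_def mesh_nodes_def)
  have orth: "barycentric_grad K v \<bullet> barycentric_grad K z = 0"
    if K: "K \<in> T" and z: "z \<in> K \<inter> Z" and v: "v \<in> K - Z" for K z v
  proof (rule discrete_laplacian_max_zero[OF w])
    \<comment> \<open>A vertex outside Z is a node below the maximum or a boundary vertex with value
      0 < m.\<close>
    have "w v \<noteq> m"
      using v m V0_outside[OF w, of v] vertex_in_dom[OF K, of v] by (cases "v \<in> \<Omega>") (auto simp: Z_def)
    then show "w v < w z" using max[of v] z by (simp add: Z_def)
    show "0 \<le> discrete_laplacian T \<Omega> w z"
      using neg max z by (force simp: Z_def)
  qed (use that max in \<open>auto simp: Z_def\<close>)
  have all: "K \<subseteq> Z" if K: "K \<in> T" and KZ: "K \<inter> Z \<noteq> {}" for K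
  proof (rule ccontr)
    assume "\<not> K \<subseteq> Z"
    then obtain v z where v: "v \<in> K" "v \<notin> Z" and z: "z \<in> K" "z \<in> Z" using KZ by auto
    define G where "G = (\<Sum>z\<in>K \<inter> Z. barycentric_grad K z)"
    have fin: "finite K" using finite_simplex[OF K] .
    have "(\<Sum>v\<in>K - Z. barycentric_grad K v) = - G"
      using sum_barycentric_grad[OF mesh_simplex[OF K]] sum.Int_Diff[OF fin, of "barycentric_grad K" Z]
      by (simp add: G_def add_eq_0_iff2)
    then have "- G \<bullet> G = (\<Sum>v\<in>K - Z. barycentric_grad K v) \<bullet> (\<Sum>z\<in>K \<inter> Z. barycentric_grad K z)"
      by (simp add: G_def)
    also have "\<dots> = (\<Sum>v\<in>K - Z. \<Sum>z\<in>K \<inter> Z. barycentric_grad K v \<bullet> barycentric_grad K z)"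
      unfolding inner_sum_left by (simp only: inner_sum_right)
    also have "\<dots> = 0" using orth[OF K] by (intro sum.neutral ballI) auto
    finally have "G = 0" by simp
    \<comment> \<open>The sum of the coordinates over \<open>K \<inter> Z\<close> has gradient G =
      0, yet it is 1 at z and 0 at v.\<close>
    then have "(\<Sum>u\<in>K \<inter> Z. barycentric K u z - barycentric K u v) = 0"
      by (simp add: barycentric_diff inner_sum_left[symmetric] G_def)
    moreover have "(\<Sum>u\<in>K \<inter> Z. barycentric K u z) = (\<Sum>u\<in>K \<inter> Z. if u = z then 1 else 0)"
      using z by (intro sum.cong) (auto simp: barycentric_vertex[OF mesh_simplex[OF K]])
    then have "(\<Sum>u\<in>K \<inter> Z. barycentric K u z) = 1" using z fin by (simp add: sum.delta')
    moreover have "(\<Sum>u\<in>K \<inter> Z. barycentric K u v) = 0"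
      using v by (intro sum.neutral) (auto simp: barycentric_vertex[OF mesh_simplex[OF K]])
    ultimately show False by (simp add: sum_subtractf)
  qed
  let ?C = "\<Union>K\<in>{K\<in>T. K \<subseteq> Z}. convex hull K" and ?D = "\<Union>K\<in>{K\<in>T. \<not> K \<subseteq> Z}. convex hull K"
  have closed: "closed ?C" "closed ?D"
    using finite_mesh finite_simplex
    by (auto intro!: closed_UN compact_imp_closed finite_imp_compact_convex_hull)
  have cover: "closure \<Omega> \<subseteq> ?C \<union> ?D"
    unfolding mesh_cover[symmetric] UN_Un[symmetric] by (rule UN_mono) auto
  \<comment> \<open>A common point of two simplices forces a common vertex by conformity; if one
    simplex lies in Z, the other meets Z and so lies in Z by \<open>all\<close>.\<close>
  have disj: "?C \<inter> ?D \<inter> closure \<Omega> = {}"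
  proof (rule ccontr)
    assume "\<not> ?thesis"
    then obtain K K' x where K: "K \<in> T" "K \<subseteq> Z" "K' \<in> T" "\<not> K' \<subseteq> Z"
        and "x \<in> convex hull K \<inter> convex hull K'" by blast
    then have "convex hull (K \<inter> K') \<noteq> {}" using mesh_conforming by blast
    then have "K' \<inter> Z \<noteq> {}" using K(2) by auto
    then show False using all K by blast
  qed
  have "z\<^sub>0 \<in> ?C \<inter> closure \<Omega>"
  proof -
    obtain K where K: "K \<in> T" "z\<^sub>0 \<in> K" using z0 by (auto simp: mesh_nodes_def)
    then have "K \<subseteq> Z" using all[OF K(1)] z0 by (auto simp: Z_def)
    moreover have "z\<^sub>0 \<in> convex hull K" using K(2) by (rule hull_inc)
    moreover have "z\<^sub>0 \<in> closure \<Omega>" using K vertices_subset_closure by blast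
    ultimately show ?thesis using K(1) by blast
  qed
  moreover have "connected (closure \<Omega>)" using convex_dom by (intro convex_connected convex_closure)
  ultimately have "?D \<inter> closure \<Omega> = {}"
    using connected_closedD[OF _ disj cover closed] by blast
  then have "closure \<Omega> - ?D = closure \<Omega>" by (simp only: Diff_triv Int_commute)
  moreover have "closure \<Omega> - ?D \<subseteq> ?C" using cover by (simp only: Diff_subset_conv Un_commute)
  ultimately have "closure \<Omega> \<subseteq> ?C" by (simp only:)
  \<comment> \<open>Nodes lie in \<Omega>, and so do hulls of nodes by convexity. Hence \<Omega>
    would be closed as well as open, although it is bounded and contains
    \<open>z\<^sub>0\<close>.\<close>
  also have "?C \<subseteq> \<Omega>"
  proof (rule UN_least)
    fix K assume "K \<in> {K\<in>T. K \<subseteq> Z}"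
    then have "K \<subseteq> \<Omega>" using Z_dom by blast
    then show "convex hull K \<subseteq> \<Omega>" using convex_dom by (rule hull_minimal)
  qed
  finally have "closed \<Omega>" using closure_subset_eq by blast
  then have "\<Omega> = {} \<or> \<Omega> = UNIV" using open_dom clopen by blast
  then show False using z0 bounded_dom not_bounded_UNIV by (auto simp: mesh_nodes_def)
qed

end

text \<open>J stands for the inf-sup of the nonlocal operators. It contributes weak comparison only,
  so strictness rests on the Laplacian and on \<kappa> > 0.\<close>

lemma (in acute_mesh) monotone_scheme_unique_solution:
  fixes J :: "(real^'d \<Rightarrow> real) \<Rightarrow> real^'d \<Rightarrow> real" and g :: "real^'d \<Rightarrow> real"
  assumes \<kappa>: "0 < \<kappa>"
    and J_mono: "\<And>u v z. u \<in> V0 T \<Omega> \<Longrightarrow> v \<in> V0 T \<Omega> \<Longrightarrow> z \<in> nodes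
      \<Longrightarrow> (\<And>x. u x - v x \<le> u z - v z) \<Longrightarrow> J u z \<le> J v z"
    and J_hom: "\<And>t u z. u \<in> V0 T \<Omega> \<Longrightarrow> z \<in> nodes \<Longrightarrow> 0 \<le> t \<Longrightarrow> J (\<lambda>x. t * u x) z = t * J u z"
    and J_lip: "\<And>z. z \<in> nodes \<Longrightarrow> \<exists>C. \<forall>u\<in>V0 T \<Omega>. \<forall>v\<in>V0 T \<Omega>. \<forall>d\<ge>0.
      (\<forall>x. \<bar>u x - v x\<bar> \<le> d) \<longrightarrow> \<bar>J u z - J v z\<bar> \<le> C * d"
  shows "\<exists>!u. u \<in> V0 T \<Omega> \<and> (\<forall>z\<in>nodes. \<kappa> * discrete_laplacian T \<Omega> u z + J u z = g z)"
proof -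
  let ?L = "discrete_laplacian T \<Omega>"
  define F where "F u z = \<kappa> * ?L u z + J u z" for u z
  have L_diff: "?L (\<lambda>x. u x - v x) z = ?L u z - ?L v z"
    if "u \<in> V0 T \<Omega>" "v \<in> V0 T \<Omega>" "z \<in> nodes" for u v z
    using discrete_laplacian_linear[OF that, of 1 "- 1"] by simp
  have strict: "\<exists>z\<in>nodes. F u z < F v z"
    if u: "u \<in> V0 T \<Omega>" and v: "v \<in> V0 T \<Omega>" and y: "y \<in> nodes" "v y < u y" for u v y
  proof -
    have "0 < u y - v y" using y by simp
    from discrete_laplacian_strong_max[OF V0_diff[OF u v] y(1) this]
    obtain z where z: "z \<in> nodes" "\<And>x. u x - v x \<le> u z - v z" "?L (\<lambda>x. u x - v x) z < 0"
      by auto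
    then have "?L u z < ?L v z" using L_diff[OF u v] by simp
    then have "F u z < F v z"
      unfolding F_def using J_mono[OF u v z(1,2)] \<kappa> by (intro add_less_le_mono mult_strict_left_mono)
    then show ?thesis using z(1) by blast
  qed
  obtain C1 where C1: "\<And>z. z \<in> nodes \<Longrightarrow> 0 \<le> C1 z"
    "\<And>z w d. z \<in> nodes \<Longrightarrow> w \<in> V0 T \<Omega> \<Longrightarrow> (\<And>x. \<bar>w x\<bar> \<le> d) \<Longrightarrow> \<bar>?L w z\<bar> \<le> C1 z * d"
    using discrete_laplacian_bound by metis
  obtain C2 where C2: "\<And>z u v d. z \<in> nodes \<Longrightarrow> u \<in> V0 T \<Omega> \<Longrightarrow> v \<in> V0 T \<Omega> \<Longrightarrow> 0 \<le> d
      \<Longrightarrow> (\<And>x. \<bar>u x - v x\<bar> \<le> d) \<Longrightarrow> \<bar>J u z - J v z\<bar> \<le> C2 z * d"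
    using J_lip by metis
  \<comment> \<open>\<open>C2\<close> comes without a sign; the summand 1 makes K positive, since
    the relaxation divides by it.\<close>
  define K where "K z = \<kappa> * C1 z + \<bar>C2 z\<bar> + 1" for z
  have "\<exists>c. \<forall>z\<in>nodes. F (interp c) z = g z"
  proof (rule homogeneous_monotone_system_solvable[OF finite_nodes, where K = K])
    fix u v :: "real^'d \<Rightarrow> real" and z
    assume z: "z \<in> nodes" and le: "v z \<le> u z" and max: "\<And>y. y \<in> nodes \<Longrightarrow> u y - v y \<le> u z - v z"
    have zz: "interp u z - interp v z = u z - v z" using z by (simp add: interp_node)
    \<comment> \<open>Passing from nodes to all x uses \<open>V0_le\<close>, whose bound must be
      nonnegative; this is why \<open>v z \<le> u z\<close> is assumed.\<close>
    have max': "interp u x - interp v x \<le> interp u z - interp v z" for x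
      unfolding zz
      by (rule V0_le[OF V0_diff[OF interp_in_V0 interp_in_V0]]) (use le max in \<open>auto simp: interp_node\<close>)
    have "?L (interp u) z \<le> ?L (interp v) z"
      using discrete_laplacian_max_nonpos[OF V0_diff[OF interp_in_V0 interp_in_V0] z max']
      by (simp add: L_diff interp_in_V0 z)
    then show "F (interp u) z \<le> F (interp v) z"
      unfolding F_def using J_mono[OF interp_in_V0 interp_in_V0 z max'] \<kappa>
      by (intro add_mono mult_left_mono) auto
  next
    fix u v :: "real^'d \<Rightarrow> real" and y assume "y \<in> nodes" "v y < u y"
    then show "\<exists>z\<in>nodes. F (interp u) z < F (interp v) z"
      by (intro strict[OF interp_in_V0 interp_in_V0, of y]) (auto simp: interp_node)
  next
    fix t :: real and u :: "real^'d \<Rightarrow> real" and z assume z: "z \<in> nodes" and t: "0 \<le> t"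
    have "interp (\<lambda>y. t * u y) = (\<lambda>x. t * interp u x)"
      using interp_linear[of t u 0 u] by auto
    moreover have "?L (\<lambda>x. t * interp u x) z = t * ?L (interp u) z"
      using discrete_laplacian_linear[OF interp_in_V0 interp_in_V0 z, of t u 0 u] by simp
    ultimately show "F (interp (\<lambda>y. t * u y)) z = t * F (interp u) z"
      by (simp add: F_def J_hom[OF interp_in_V0 z t] algebra_simps)
  next
    fix u v :: "real^'d \<Rightarrow> real" and d z
    assume z: "z \<in> nodes" and uv: "\<And>y. y \<in> nodes \<Longrightarrow> \<bar>u y - v y\<bar> \<le> d" and d: "0 \<le> d"
    have le: "\<bar>interp u x - interp v x\<bar> \<le> d" for x
      by (rule V0_abs_le[OF V0_diff[OF interp_in_V0 interp_in_V0] d]) (use uv in \<open>auto simp: interp_node\<close>)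
    have L: "\<bar>?L (interp u) z - ?L (interp v) z\<bar> \<le> C1 z * d"
      using C1(2)[OF z V0_diff[OF interp_in_V0 interp_in_V0] le] by (simp add: L_diff interp_in_V0 z)
    have "\<bar>F (interp u) z - F (interp v) z\<bar>
        = \<bar>\<kappa> * (?L (interp u) z - ?L (interp v) z) + (J (interp u) z - J (interp v) z)\<bar>"
      by (simp add: F_def algebra_simps)
    also have "\<dots> \<le> \<kappa> * \<bar>?L (interp u) z - ?L (interp v) z\<bar> + \<bar>J (interp u) z - J (interp v) z\<bar>"
      using \<kappa> by (intro order_trans[OF abs_triangle_ineq]) (simp add: abs_mult)
    also have "\<dots> \<le> \<kappa> * (C1 z * d) + C2 z * d"
      using \<kappa> L C2[OF z interp_in_V0 interp_in_V0 d le] by (intro add_mono mult_left_mono) auto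
    also have "\<dots> \<le> \<kappa> * (C1 z * d) + (\<bar>C2 z\<bar> + 1) * d"
      using d by (intro add_left_mono mult_right_mono) auto
    also have "\<dots> = K z * d" by (simp add: K_def algebra_simps)
    finally show "\<bar>F (interp u) z - F (interp v) z\<bar> \<le> K z * d" .
  next
    fix z assume "z \<in> nodes"
    then have "0 \<le> \<kappa> * C1 z" using C1(1) \<kappa> by simp
    then show "0 < K z" by (simp add: K_def)
  qed
  then obtain c where c: "\<And>z. z \<in> nodes \<Longrightarrow> F (interp c) z = g z" by blast
  show ?thesis
  proof (rule ex1I[of _ "interp c"])
    show "interp c \<in> V0 T \<Omega> \<and> (\<forall>z\<in>nodes. \<kappa> * ?L (interp c) z + J (interp c) z = g z)"
      using interp_in_V0 c by (simp add: F_def)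
  next
    fix u assume u: "u \<in> V0 T \<Omega> \<and> (\<forall>z\<in>nodes. \<kappa> * ?L u z + J u z = g z)"
    then have Fu: "F u z = F (interp c) z" if "z \<in> nodes" for z using c that by (simp add: F_def)
    have "c z = u z" if "z \<in> nodes" for z
      using strict[of u "interp c" z] strict[of "interp c" u z] u interp_in_V0 Fu that
      by (metis interp_node less_irrefl linorder_neqE_linordered_idom)
    then show "u = interp c" using interp_V0_eq u by metis
  qed
qed

subsection \<open>The nonlocal operator\<close>

lemma matrix_inv_right:
  "invertible M \<Longrightarrow> M ** matrix_inv M = mat 1"
  unfolding invertible_def matrix_inv_def by (rule conjunct1[OF someI_ex])

text \<open>One coefficient field and one point x are fixed, since the kernel itself depends on x
  through \<open>Mmat lam A x\<close>.\<close>

locale nonlocal_kernel =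
  fixes \<phi> :: "real^'d::finite \<Rightarrow> real" and \<epsilon> lam :: real and A :: "real^'d \<Rightarrow> real^'d^'d" and x :: "real^'d"
  assumes continuous: "continuous_on UNIV \<phi>" and nonneg: "0 \<le> \<phi> y"
    and support: "1 < norm y \<Longrightarrow> \<phi> y = 0"
    and eps: "0 < \<epsilon>" and det_pos: "0 < det (Mmat lam A x)"
begin

definition kernel :: "real^'d \<Rightarrow> real" where
  "kernel y = \<phi> ((1 / \<epsilon>) *\<^sub>R (matrix_inv (Mmat lam A x) *v y))"

definition scale :: real where
  "scale = 1 / (\<epsilon> ^ (CARD('d) + 2) * det (Mmat lam A x))"

lemma scale_pos: "0 < scale"
  using eps det_pos by (simp add: scale_def)

lemma nonlocal_op_eq:
  "nonlocal_op \<phi> \<epsilon> lam A w x = scale * integral UNIV (\<lambda>y. second_diff w x y * kernel y)"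
  by (simp add: nonlocal_op_def scale_def kernel_def)

lemma kernel_nonneg: "0 \<le> kernel y"
  by (simp add: kernel_def nonneg)

lemma continuous_kernel: "continuous_on UNIV kernel"
  unfolding kernel_def
  by (intro continuous_on_compose2[OF continuous] continuous_intros
      linear_continuous_on matrix_vector_mul_bounded_linear) auto

text \<open>On the support the inverse of M maps y into the ball of radius \<epsilon>; applying M
  again bounds y by \<epsilon> times a norm bound of M.\<close>

lemma kernel_compact_support: "\<exists>a. \<forall>y. y \<notin> cbox (- a) a \<longrightarrow> kernel y = 0"
proof -
  let ?M = "Mmat lam A x"
  obtain B where B: "0 < B" "\<And>y. norm (?M *v y) \<le> B * norm y"
    using linear_bounded_pos[of "(*v) ?M"] by auto
  have inv: "invertible ?M" using det_pos by (simp add: invertible_det_nz)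
  have "norm y \<le> B * \<epsilon>" if "kernel y \<noteq> 0" for y
  proof -
    have "norm ((1 / \<epsilon>) *\<^sub>R (matrix_inv ?M *v y)) \<le> 1"
      using support that by (force simp: kernel_def not_less[symmetric])
    then have le: "norm (matrix_inv ?M *v y) \<le> \<epsilon>" using eps by (simp add: divide_le_eq)
    have "y = ?M *v (matrix_inv ?M *v y)"
      using matrix_inv_right[OF inv] by (simp add: matrix_vector_mul_assoc)
    then have "norm y \<le> B * norm (matrix_inv ?M *v y)" using B(2) by metis
    also have "\<dots> \<le> B * \<epsilon>" using le B(1) by simp
    finally show ?thesis .
  qed
  then have "bounded {y. kernel y \<noteq> 0}" by (intro boundedI) auto
  then obtain a where "{y. kernel y \<noteq> 0} \<subseteq> cbox (- a) a"
    using bounded_subset_cbox_symmetric by blast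
  then show ?thesis by (intro exI[of _ a]) auto
qed

lemma integrable_times_kernel:
  assumes "continuous_on UNIV w"
  shows "(\<lambda>y. w y * kernel y) integrable_on UNIV"
proof -
  obtain a where a: "\<And>y. y \<notin> cbox (- a) a \<Longrightarrow> kernel y = 0"
    using kernel_compact_support by blast
  have "(\<lambda>y. w y * kernel y) integrable_on cbox (- a) a"
    by (intro integrable_continuous continuous_intros continuous_on_subset[OF assms]
        continuous_on_subset[OF continuous_kernel]) auto
  then have "(\<lambda>y. if y \<in> cbox (- a) a then w y * kernel y else 0) integrable_on UNIV"
    by (simp only: integrable_restrict_UNIV)
  moreover have "(\<lambda>y. if y \<in> cbox (- a) a then w y * kernel y else 0) = (\<lambda>y. w y * kernel y)"
    using a by (intro ext) auto
  ultimately show ?thesis by (simp only:)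
qed

lemma continuous_second_diff:
  assumes "continuous_on UNIV w"
  shows "continuous_on UNIV (second_diff w x)"
  unfolding second_diff_def
  by (intro continuous_intros continuous_on_compose2[OF assms]) auto

lemma integrable_second_diff:
  "continuous_on UNIV w \<Longrightarrow> (\<lambda>y. second_diff w x y * kernel y) integrable_on UNIV"
  by (intro integrable_times_kernel continuous_second_diff)

lemma nonlocal_op_linear:
  assumes u: "continuous_on UNIV u" and v: "continuous_on UNIV v"
  shows "nonlocal_op \<phi> \<epsilon> lam A (\<lambda>y. a * u y + b * v y) x
    = a * nonlocal_op \<phi> \<epsilon> lam A u x + b * nonlocal_op \<phi> \<epsilon> lam A v x"
proof -
  have "((\<lambda>y. a * (second_diff u x y * kernel y) + b * (second_diff v x y * kernel y)) has_integral
      a * integral UNIV (\<lambda>y. second_diff u x y * kernel y)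
      + b * integral UNIV (\<lambda>y. second_diff v x y * kernel y)) UNIV"
    by (intro has_integral_add has_integral_mult_right integrable_integral integrable_second_diff u v)
  moreover have "(\<lambda>y. a * (second_diff u x y * kernel y) + b * (second_diff v x y * kernel y))
      = (\<lambda>y. second_diff (\<lambda>y. a * u y + b * v y) x y * kernel y)"
    by (simp add: second_diff_def fun_eq_iff algebra_simps)
  ultimately have "integral UNIV (\<lambda>y. second_diff (\<lambda>y. a * u y + b * v y) x y * kernel y)
      = a * integral UNIV (\<lambda>y. second_diff u x y * kernel y)
      + b * integral UNIV (\<lambda>y. second_diff v x y * kernel y)"
    by (simp add: integral_unique)
  then show ?thesis by (simp add: nonlocal_op_eq algebra_simps)
qed

lemma nonlocal_op_max_nonpos:
  assumes w: "continuous_on UNIV w" and max: "\<And>y. w y \<le> w x"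
  shows "nonlocal_op \<phi> \<epsilon> lam A w x \<le> 0"
proof -
  have "second_diff w x y * kernel y \<le> 0" for y
    using kernel_nonneg[of y] max[of "x + y"] max[of "x - y"]
    by (intro mult_nonpos_nonneg) (auto simp: second_diff_def)
  then have "integral UNIV (\<lambda>y. second_diff w x y * kernel y) \<le> integral UNIV (\<lambda>y::real^'d. 0)"
    by (intro integral_le[OF integrable_second_diff[OF w] integrable_0])
  then show ?thesis using scale_pos by (simp add: nonlocal_op_eq mult_nonneg_nonpos)
qed

lemma nonlocal_op_bound:
  assumes w: "continuous_on UNIV w" and d: "\<And>y. \<bar>w y\<bar> \<le> d"
  shows "\<bar>nonlocal_op \<phi> \<epsilon> lam A w x\<bar> \<le> scale * 4 * integral UNIV kernel * d"
proof -
  have k: "kernel integrable_on UNIV"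
    using integrable_times_kernel[of "\<lambda>_. 1"] by simp
  \<comment> \<open>The coefficients 1, -2, 1 have total modulus 4.\<close>
  have le: "\<bar>second_diff w x y\<bar> \<le> 4 * d" for y
    using d[of "x + y"] d[of x] d[of "x - y"] by (simp add: second_diff_def abs_le_iff)
  have "norm (integral UNIV (\<lambda>y. second_diff w x y * kernel y)) \<le> integral UNIV (\<lambda>y. 4 * d * kernel y)"
  proof (rule integral_norm_bound_integral)
    show "(\<lambda>y. 4 * d * kernel y) integrable_on UNIV" using k by (rule integrable_on_mult_right)
    show "norm (second_diff w x y * kernel y) \<le> 4 * d * kernel y" for y
      using le[of y] kernel_nonneg[of y] by (simp add: abs_mult mult_right_mono)
  qed (rule integrable_second_diff[OF w])
  also have "\<dots> = 4 * d * integral UNIV kernel" by simp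
  finally show ?thesis
    using scale_pos by (simp add: nonlocal_op_eq abs_mult mult_ac)
qed

end

text \<open>One estimate for two purposes: e = 0 gives monotonicity, and a positive e, used in both
  directions, gives the Lipschitz bound.\<close>

lemma INF_SUP_mono_add:
  fixes g h :: "'a \<Rightarrow> 'b \<Rightarrow> real"
  assumes fin: "finite \<A>" "\<A> \<noteq> {}" "finite \<B>" "\<B> \<noteq> {}"
    and le: "\<And>\<alpha> \<beta>. \<alpha> \<in> \<A> \<Longrightarrow> \<beta> \<in> \<B> \<Longrightarrow> g \<alpha> \<beta> \<le> h \<alpha> \<beta> + e"
  shows "(INF \<alpha>\<in>\<A>. SUP \<beta>\<in>\<B>. g \<alpha> \<beta>) \<le> (INF \<alpha>\<in>\<A>. SUP \<beta>\<in>\<B>. h \<alpha> \<beta>) + e"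
proof -
  have sup: "(SUP \<beta>\<in>\<B>. g \<alpha> \<beta>) \<le> (SUP \<beta>\<in>\<B>. h \<alpha> \<beta>) + e" if \<alpha>: "\<alpha> \<in> \<A>" for \<alpha>
  proof (rule cSUP_least[OF fin(4)])
    fix \<beta> assume \<beta>: "\<beta> \<in> \<B>"
    have "h \<alpha> \<beta> \<le> (SUP \<beta>\<in>\<B>. h \<alpha> \<beta>)" using \<beta> fin(3) by (intro cSUP_upper) auto
    then show "g \<alpha> \<beta> \<le> (SUP \<beta>\<in>\<B>. h \<alpha> \<beta>) + e" using le[OF \<alpha> \<beta>] by simp
  qed
  have "(INF \<alpha>\<in>\<A>. SUP \<beta>\<in>\<B>. g \<alpha> \<beta>) - e \<le> (INF \<alpha>\<in>\<A>. SUP \<beta>\<in>\<B>. h \<alpha> \<beta>)"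
  proof (rule cINF_greatest[OF fin(2)])
    fix \<alpha> assume \<alpha>: "\<alpha> \<in> \<A>"
    have "(INF \<alpha>\<in>\<A>. SUP \<beta>\<in>\<B>. g \<alpha> \<beta>) \<le> (SUP \<beta>\<in>\<B>. g \<alpha> \<beta>)"
      using \<alpha> fin(1) by (intro cINF_lower) auto
    then show "(INF \<alpha>\<in>\<A>. SUP \<beta>\<in>\<B>. g \<alpha> \<beta>) - e \<le> (SUP \<beta>\<in>\<B>. h \<alpha> \<beta>)"
      using sup[OF \<alpha>] by simp
  qed
  then show ?thesis by simp
qed

text \<open>Over finite sets inf and sup are \<open>Min\<close> and \<open>Max\<close>, which
  commute with the monotone map given by t \<ge> 0.\<close>

lemma INF_SUP_mult_left:
  fixes g :: "'a \<Rightarrow> 'b \<Rightarrow> real"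
  assumes fin: "finite \<A>" "\<A> \<noteq> {}" "finite \<B>" "\<B> \<noteq> {}" and t: "0 \<le> t"
  shows "(INF \<alpha>\<in>\<A>. SUP \<beta>\<in>\<B>. t * g \<alpha> \<beta>) = t * (INF \<alpha>\<in>\<A>. SUP \<beta>\<in>\<B>. g \<alpha> \<beta>)"
proof -
  have mono: "mono ((*) t)" using t by (simp add: mono_def mult_left_mono)
  have sup: "(SUP \<beta>\<in>\<B>. t * g \<alpha> \<beta>) = t * (SUP \<beta>\<in>\<B>. g \<alpha> \<beta>)" for \<alpha>
    using mono_Max_commute[OF mono, of "g \<alpha> ` \<B>"] fin by (simp add: cSup_eq_Max image_image)
  show ?thesis
    unfolding sup
    using mono_Min_commute[OF mono, of "(\<lambda>\<alpha>. SUP \<beta>\<in>\<B>. g \<alpha> \<beta>) ` \<A>"] fin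
    by (simp add: cInf_eq_Min image_image)
qed

lemma smooth_fun_continuous: "smooth_fun \<phi> \<Longrightarrow> continuous_on UNIV \<phi>"
  unfolding smooth_fun_def
  by (metis differentiable_imp_continuous_within continuous_at_imp_continuous_on iter_partial.simps(1))

theorem theorem3p4:
  fixes \<Omega> :: "(real^'d::finite) set"
    and f :: "real^'d \<Rightarrow> real"
    and \<A> :: "'a set" and \<B> :: "'b set"
    and A :: "'a \<Rightarrow> 'b \<Rightarrow> real^'d \<Rightarrow> real^'d^'d"
    and lam \<Lambda> :: real
    and \<phi> :: "real^'d \<Rightarrow> real"
    and H :: "real set"
    and T :: "real \<Rightarrow> (real^'d) set set"
  assumes dim: "CARD('d) \<ge> 2"
    and \<Omega>: "open \<Omega>" "bounded \<Omega>" "convex \<Omega>"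
    and f_lip: "\<exists>L. L-lipschitz_on (closure \<Omega>) f"
    and AB: "finite \<A>" "\<A> \<noteq> {}" "finite \<B>" "\<B> \<noteq> {}"
    and lam: "0 < lam" "lam \<le> \<Lambda>"
    and A_lip: "\<And>\<alpha> \<beta>. \<alpha> \<in> \<A> \<Longrightarrow> \<beta> \<in> \<B> \<Longrightarrow> \<exists>L. L-lipschitz_on (closure \<Omega>) (A \<alpha> \<beta>)"
    and A_sym: "\<And>\<alpha> \<beta> x. \<alpha> \<in> \<A> \<Longrightarrow> \<beta> \<in> \<B> \<Longrightarrow> x \<in> closure \<Omega> \<Longrightarrow> sym_matrix (A \<alpha> \<beta> x)"
    and A_ell: "\<And>\<alpha> \<beta> x v. \<alpha> \<in> \<A> \<Longrightarrow> \<beta> \<in> \<B> \<Longrightarrow> x \<in> closure \<Omega> \<Longrightarrow>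
                  lam * (v \<bullet> v) \<le> v \<bullet> (A \<alpha> \<beta> x *v v) \<and> v \<bullet> (A \<alpha> \<beta> x *v v) \<le> \<Lambda> * (v \<bullet> v)"
    and \<phi>_smooth: "smooth_fun \<phi>"
    and \<phi>_rad: "radially_symmetric \<phi>"
    and \<phi>_nonneg: "\<And>y. 0 \<le> \<phi> y"
    and \<phi>_supp: "\<And>y. 1 < norm y \<Longrightarrow> \<phi> y = 0"
    and \<phi>_moment: "integral UNIV (\<lambda>y. (norm y)\<^sup>2 * \<phi> y) = real CARD('d)"
    and H: "\<And>h. h \<in> H \<Longrightarrow> 0 < h"
    and mesh: "\<And>h. h \<in> H \<Longrightarrow> simplicial_mesh (T h) \<Omega>"
    and qu: "quasi_uniform_family H T"
    and acute: "\<And>h. h \<in> H \<Longrightarrow> weakly_acute (T h)"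
  shows "\<forall>h\<in>H. \<forall>\<epsilon>>0. \<exists>!u. u \<in> V0 (T h) \<Omega> \<and>
           (\<forall>z\<in>mesh_nodes (T h) \<Omega>.
              (lam / 2) * discrete_laplacian (T h) \<Omega> u z
              + (INF \<alpha>\<in>\<A>. SUP \<beta>\<in>\<B>. nonlocal_op \<phi> \<epsilon> lam (A \<alpha> \<beta>) u z)
              = nodal_average (T h) \<Omega> f z)"
proof (intro ballI allI impI)
  fix h \<epsilon> :: real assume h: "h \<in> H" and \<epsilon>: "0 < \<epsilon>"
  interpret acute_mesh "T h" \<Omega>
    using \<Omega> mesh[OF h] acute[OF h] by unfold_locales
  let ?V = "V0 (T h) \<Omega>"
  have V_cont: "continuous_on UNIV w" if "w \<in> ?V" for w using that by (simp add: V0_def)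
  have ker: "nonlocal_kernel \<phi> \<epsilon> lam (A \<alpha> \<beta>) z" if "\<alpha> \<in> \<A>" "\<beta> \<in> \<B>" "z \<in> nodes" for \<alpha> \<beta> z
  proof
    \<comment> \<open>Symmetry and ellipticity of the coefficients are given on the closure of
      \<Omega> only, which contains the nodes.\<close>
    have z: "z \<in> closure \<Omega>" using that closure_subset by (auto simp: mesh_nodes_def)
    show "0 < det (Mmat lam (A \<alpha> \<beta>) z)"
      using A_sym[OF that(1,2) z] A_ell[OF that(1,2) z] lam(1) by (intro Mmat_det_pos) auto
  qed (use \<epsilon> \<phi>_nonneg \<phi>_supp smooth_fun_continuous[OF \<phi>_smooth] in auto)
  note I_lin = nonlocal_kernel.nonlocal_op_linear[OF ker V_cont V_cont]
  have I_diff: "nonlocal_op \<phi> \<epsilon> lam (A \<alpha> \<beta>) (\<lambda>x. u x - v x) z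
      = nonlocal_op \<phi> \<epsilon> lam (A \<alpha> \<beta>) u z - nonlocal_op \<phi> \<epsilon> lam (A \<alpha> \<beta>) v z"
    if "\<alpha> \<in> \<A>" "\<beta> \<in> \<B>" "z \<in> nodes" "u \<in> ?V" "v \<in> ?V" for \<alpha> \<beta> z u v
    using I_lin[OF that, of 1 "- 1"] by simp
  show "\<exists>!u. u \<in> ?V \<and> (\<forall>z\<in>nodes. (lam / 2) * discrete_laplacian (T h) \<Omega> u z
      + (INF \<alpha>\<in>\<A>. SUP \<beta>\<in>\<B>. nonlocal_op \<phi> \<epsilon> lam (A \<alpha> \<beta>) u z) = nodal_average (T h) \<Omega> f z)"
  proof (rule monotone_scheme_unique_solution)
    show "0 < lam / 2" using lam by simp
  next
    fix u v z assume uv: "u \<in> ?V" "v \<in> ?V" and z: "z \<in> nodes"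
      and max: "\<And>x. u x - v x \<le> u z - v z"
    have "nonlocal_op \<phi> \<epsilon> lam (A \<alpha> \<beta>) u z \<le> nonlocal_op \<phi> \<epsilon> lam (A \<alpha> \<beta>) v z + 0"
      if "\<alpha> \<in> \<A>" "\<beta> \<in> \<B>" for \<alpha> \<beta>
      using nonlocal_kernel.nonlocal_op_max_nonpos[OF ker[OF that z] V_cont[OF V0_diff[OF uv]] max]
        I_diff[OF that z uv] by simp
    from INF_SUP_mono_add[OF AB this]
    show "(INF \<alpha>\<in>\<A>. SUP \<beta>\<in>\<B>. nonlocal_op \<phi> \<epsilon> lam (A \<alpha> \<beta>) u z)
        \<le> (INF \<alpha>\<in>\<A>. SUP \<beta>\<in>\<B>. nonlocal_op \<phi> \<epsilon> lam (A \<alpha> \<beta>) v z)" by simp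
  next
    fix t :: real and u z assume u: "u \<in> ?V" and z: "z \<in> nodes" and t: "0 \<le> t"
    have "nonlocal_op \<phi> \<epsilon> lam (A \<alpha> \<beta>) (\<lambda>x. t * u x) z = t * nonlocal_op \<phi> \<epsilon> lam (A \<alpha> \<beta>) u z"
      if "\<alpha> \<in> \<A>" "\<beta> \<in> \<B>" for \<alpha> \<beta>
      using I_lin[OF that z u u, of t 0] by simp
    then have "(INF \<alpha>\<in>\<A>. SUP \<beta>\<in>\<B>. nonlocal_op \<phi> \<epsilon> lam (A \<alpha> \<beta>) (\<lambda>x. t * u x) z)
        = (INF \<alpha>\<in>\<A>. SUP \<beta>\<in>\<B>. t * nonlocal_op \<phi> \<epsilon> lam (A \<alpha> \<beta>) u z)"
      by (intro INF_cong SUP_cong refl)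
    then show "(INF \<alpha>\<in>\<A>. SUP \<beta>\<in>\<B>. nonlocal_op \<phi> \<epsilon> lam (A \<alpha> \<beta>) (\<lambda>x. t * u x) z)
        = t * (INF \<alpha>\<in>\<A>. SUP \<beta>\<in>\<B>. nonlocal_op \<phi> \<epsilon> lam (A \<alpha> \<beta>) u z)"
      by (simp only: INF_SUP_mult_left[OF AB t])
  next
    fix z assume z: "z \<in> nodes"
    define C where "C \<alpha> \<beta> = nonlocal_kernel.scale \<epsilon> lam (A \<alpha> \<beta>) z * 4
      * integral UNIV (nonlocal_kernel.kernel \<phi> \<epsilon> lam (A \<alpha> \<beta>) z)" for \<alpha> \<beta>
    \<comment> \<open>A bound uniform in \<alpha> and \<beta>, available because both index sets are
      finite.\<close>
    define M where "M = (\<Sum>\<alpha>\<in>\<A>. \<Sum>\<beta>\<in>\<B>. \<bar>C \<alpha> \<beta>\<bar>)"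
    have CM: "C \<alpha> \<beta> \<le> M" if "\<alpha> \<in> \<A>" "\<beta> \<in> \<B>" for \<alpha> \<beta>
    proof -
      have "\<bar>C \<alpha> \<beta>\<bar> \<le> (\<Sum>\<beta>\<in>\<B>. \<bar>C \<alpha> \<beta>\<bar>)"
        using that AB by (intro member_le_sum[of \<beta> \<B> "\<lambda>\<beta>. \<bar>C \<alpha> \<beta>\<bar>"]) auto
      also have "\<dots> \<le> M"
        unfolding M_def using that AB
        by (intro member_le_sum[of \<alpha> \<A> "\<lambda>\<alpha>. \<Sum>\<beta>\<in>\<B>. \<bar>C \<alpha> \<beta>\<bar>"]) (auto intro: sum_nonneg)
      finally show ?thesis by simp
    qed
    have le: "nonlocal_op \<phi> \<epsilon> lam (A \<alpha> \<beta>) u z \<le> nonlocal_op \<phi> \<epsilon> lam (A \<alpha> \<beta>) v z + M * d"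
      if ab: "\<alpha> \<in> \<A>" "\<beta> \<in> \<B>" and uv: "u \<in> ?V" "v \<in> ?V" and d: "0 \<le> d" "\<And>x. \<bar>u x - v x\<bar> \<le> d"
      for \<alpha> \<beta> u v d
    proof -
      have "\<bar>nonlocal_op \<phi> \<epsilon> lam (A \<alpha> \<beta>) (\<lambda>x. u x - v x) z\<bar> \<le> C \<alpha> \<beta> * d"
        unfolding C_def
        by (rule nonlocal_kernel.nonlocal_op_bound[OF ker[OF ab z] V_cont[OF V0_diff[OF uv]] d(2)])
      also have "\<dots> \<le> M * d" using CM[OF ab] d(1) by (rule mult_right_mono)
      finally show ?thesis using I_diff[OF ab z uv] by simp
    qed
    show "\<exists>C. \<forall>u\<in>?V. \<forall>v\<in>?V. \<forall>d\<ge>0. (\<forall>x. \<bar>u x - v x\<bar> \<le> d)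
      \<longrightarrow> \<bar>(INF \<alpha>\<in>\<A>. SUP \<beta>\<in>\<B>. nonlocal_op \<phi> \<epsilon> lam (A \<alpha> \<beta>) u z)
        - (INF \<alpha>\<in>\<A>. SUP \<beta>\<in>\<B>. nonlocal_op \<phi> \<epsilon> lam (A \<alpha> \<beta>) v z)\<bar> \<le> C * d"
    proof (intro exI ballI allI impI)
      fix u v and d :: real
      assume uv: "u \<in> ?V" "v \<in> ?V" and d: "0 \<le> d" "\<forall>x. \<bar>u x - v x\<bar> \<le> d"
      have d': "\<bar>u x - v x\<bar> \<le> d" "\<bar>v x - u x\<bar> \<le> d" for x
        using d(2) by (auto simp: abs_minus_commute)
      show "\<bar>(INF \<alpha>\<in>\<A>. SUP \<beta>\<in>\<B>. nonlocal_op \<phi> \<epsilon> lam (A \<alpha> \<beta>) u z)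
        - (INF \<alpha>\<in>\<A>. SUP \<beta>\<in>\<B>. nonlocal_op \<phi> \<epsilon> lam (A \<alpha> \<beta>) v z)\<bar> \<le> M * d"
        (is "\<bar>?I u - ?I v\<bar> \<le> _")
      proof -
        have "?I u \<le> ?I v + M * d"
          by (intro INF_SUP_mono_add AB le uv d(1) d'(1))
        moreover have "?I v \<le> ?I u + M * d"
          by (intro INF_SUP_mono_add AB le uv d(1) d'(2))
        ultimately show ?thesis by linarith
      qed
    qed
  qed
qed

end
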